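(* Let $X, Y \subseteq \omega$. If $Y$ is not coarsely computable and $X$ is weakly $3$-random relative to $Y$, then the nonuniform coarse degrees of $X$ and $Y$ form a minimal pair, and hence so do their uniform coarse degrees.
   Context: For $A \subseteq \omega$ and $n \geq 1$ let $\rho_n(A) = |A \cap [0,n)|/n$; the density $\rho(A)$ is $\lim_n \rho_n(A)$ when it exists. $D$ is a coarse description of $X$ if $\rho(D \triangle X) = 0$. A set is coarsely computable if it has a computable coarse description. $Y \leq_{\mathrm{uc}} X$ if there is a Turing functional $\Phi$ such that for every coarse description $D$ of $X$, $\Phi^D$ is a coarse description of $Y$. $Y \leq_{\mathrm{nc}} X$ if every coarse description of $X$ computes a coarse description of $Y$. The equivalence classes of the induced equivalence relations are the uniform and nonuniform coarse degrees, respectively. In both structures the least degree consists of the coarsely computable sets. Two degrees form a minimal pair if both are different from the least degree and the only degree below both of them is the least degree. $X$ is weakly $3$-random relative to $Y$ if $X$ belongs to no $\Pi^{0,Y}_3$ class of measure $0$ (with respect to the uniform measure on $2^\omega$). *)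

theory Defs
  imports "HOL-Probability.Probability" "HOL-Library.Nat_Bijection"
begin

section \<open>Turing functionals\<close>

text \<open>
  Turing functionals are given by programs for the partial recursive functions relative to
  an oracle.  All programs are unary; several arguments are passed as one number via the
  bijective pairing \<^const>\<open>prod_encode\<close>.  Primitive recursion and minimisation have the
  parameter as first and the recursion (or search) variable as second component.
\<close>

datatype functional =
    Zero
  | Succ
  | Left
  | Right
  | Oracle
  | Pairing functional functional
  | Comp functional functional
  | PrimRec functional functional
  | Mu functional

text \<open>\<open>run \<Phi> A x\<close> is \<open>\<Phi>\<^sup>A(x)\<close>, with \<^const>\<open>None\<close> for divergence.\<close>

primrec run :: "functional \<Rightarrow> nat set \<Rightarrow> nat \<Rightarrow> nat option" where
  "run Zero A x = Some 0"
| "run Succ A x = Some (Suc x)"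
| "run Left A x = Some (fst (prod_decode x))"
| "run Right A x = Some (snd (prod_decode x))"
| "run Oracle A x = Some (of_bool (x \<in> A))"
| "run (Pairing f g) A x =
     Option.bind (run f A x) (\<lambda>u. Option.bind (run g A x) (\<lambda>v. Some (prod_encode (u, v))))"
| "run (Comp f g) A x = Option.bind (run g A x) (run f A)"
| "run (PrimRec f g) A x =
     (let (p, n) = prod_decode x in
      rec_nat (run f A p)
        (\<lambda>k r. Option.bind r (\<lambda>v. run g A (prod_encode (p, prod_encode (k, v))))) n)"
| "run (Mu f) A x =
     (if \<exists>n. run f A (prod_encode (x, n)) = Some 0 \<and> (\<forall>m<n. run f A (prod_encode (x, m)) \<noteq> None)
      then Some (LEAST n. run f A (prod_encode (x, n)) = Some 0)
      else None)"

text \<open>\<open>\<Phi>\<^sup>A\<close> is (the characteristic function of) the set \<open>E\<close>; in particular it is total.\<close>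

definition computes_set :: "functional \<Rightarrow> nat set \<Rightarrow> nat set \<Rightarrow> bool" where
  "computes_set \<Phi> A E \<longleftrightarrow> (\<forall>n. run \<Phi> A n = Some (of_bool (n \<in> E)))"

definition turing_le :: "nat set \<Rightarrow> nat set \<Rightarrow> bool" (infix "\<le>\<^sub>T" 50) where
  "B \<le>\<^sub>T A \<longleftrightarrow> (\<exists>\<Phi>. computes_set \<Phi> A B)"

definition computable :: "nat set \<Rightarrow> bool" where
  "computable A \<longleftrightarrow> A \<le>\<^sub>T {}"


section \<open>Coarse reducibility\<close>

definition partial_density :: "nat \<Rightarrow> nat set \<Rightarrow> real" where
  "partial_density n A = real (card (A \<inter> {0..<n})) / real n"

definition has_density :: "nat set \<Rightarrow> real \<Rightarrow> bool" where
  "has_density A d \<longleftrightarrow> (\<lambda>n. partial_density n A) \<longlonglongrightarrow> d"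

definition coarse_description :: "nat set \<Rightarrow> nat set \<Rightarrow> bool" where
  "coarse_description D X \<longleftrightarrow> has_density ((D - X) \<union> (X - D)) 0"

definition coarsely_computable :: "nat set \<Rightarrow> bool" where
  "coarsely_computable X \<longleftrightarrow> (\<exists>D. computable D \<and> coarse_description D X)"

definition uc_le :: "nat set \<Rightarrow> nat set \<Rightarrow> bool" (infix "\<le>\<^sub>u\<^sub>c" 50) where
  "Y \<le>\<^sub>u\<^sub>c X \<longleftrightarrow>
     (\<exists>\<Phi>. \<forall>D. coarse_description D X \<longrightarrow> (\<exists>E. computes_set \<Phi> D E \<and> coarse_description E Y))"

definition nc_le :: "nat set \<Rightarrow> nat set \<Rightarrow> bool" (infix "\<le>\<^sub>n\<^sub>c" 50) where
  "Y \<le>\<^sub>n\<^sub>c X \<longleftrightarrow>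
     (\<forall>D. coarse_description D X \<longrightarrow> (\<exists>E. E \<le>\<^sub>T D \<and> coarse_description E Y))"


section \<open>Degree structures and minimal pairs\<close>

text \<open>
  The degree structure of a preorder on sets of natural numbers, used below with
  \<open>uc_le\<close> and \<open>nc_le\<close>.
\<close>

definition degree_equiv :: "(nat set \<Rightarrow> nat set \<Rightarrow> bool) \<Rightarrow> (nat set \<times> nat set) set" where
  "degree_equiv le = {(A, B). le A B \<and> le B A}"

definition degrees :: "(nat set \<Rightarrow> nat set \<Rightarrow> bool) \<Rightarrow> nat set set set" where
  "degrees le = UNIV // degree_equiv le"

definition degree_of :: "(nat set \<Rightarrow> nat set \<Rightarrow> bool) \<Rightarrow> nat set \<Rightarrow> nat set set" where
  "degree_of le A = degree_equiv le `` {A}"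

definition degree_le ::
    "(nat set \<Rightarrow> nat set \<Rightarrow> bool) \<Rightarrow> nat set set \<Rightarrow> nat set set \<Rightarrow> bool" where
  "degree_le le a b \<longleftrightarrow> (\<exists>A\<in>a. \<exists>B\<in>b. le A B)"

definition least_degree :: "(nat set \<Rightarrow> nat set \<Rightarrow> bool) \<Rightarrow> nat set set \<Rightarrow> bool" where
  "least_degree le a \<longleftrightarrow> a \<in> degrees le \<and> (\<forall>b\<in>degrees le. degree_le le a b)"

definition minimal_pair ::
    "(nat set \<Rightarrow> nat set \<Rightarrow> bool) \<Rightarrow> nat set set \<Rightarrow> nat set set \<Rightarrow> bool" where
  "minimal_pair le a b \<longleftrightarrow>
     a \<in> degrees le \<and> b \<in> degrees le \<and>
     \<not> least_degree le a \<and> \<not> least_degree le b \<and>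
     (\<forall>c\<in>degrees le. degree_le le c a \<and> degree_le le c b \<longrightarrow> least_degree le c)"

abbreviation nc_degree :: "nat set \<Rightarrow> nat set set" where
  "nc_degree \<equiv> degree_of nc_le"

abbreviation uc_degree :: "nat set \<Rightarrow> nat set set" where
  "uc_degree \<equiv> degree_of uc_le"


section \<open>Weak 3-randomness\<close>

text \<open>The (code of the) binary string \<open>X(0) X(1) \<dots> X(n - 1)\<close>.\<close>

definition initial_segment :: "nat set \<Rightarrow> nat \<Rightarrow> nat" where
  "initial_segment X n = list_encode (map (\<lambda>i. of_bool (i \<in> X)) [0..<n])"

text \<open>
  A \<open>\<Pi>\<^sup>0\<^sub>3\<close> class relative to \<open>Y\<close> is of the form
  \<open>{X. \<forall>a. \<exists>b. \<forall>c. R(a, b, X \<restriction> c)}\<close> with \<open>R\<close> computable from \<open>Y\<close>.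
\<close>

definition Pi03_class :: "nat set \<Rightarrow> nat set set \<Rightarrow> bool" where
  "Pi03_class Y C \<longleftrightarrow>
     (\<exists>R. R \<le>\<^sub>T Y \<and>
        C = {X. \<forall>a. \<exists>b. \<forall>c. prod_encode (a, prod_encode (b, initial_segment X c)) \<in> R})"

definition coin_measure :: "(nat \<Rightarrow> bool) measure" where
  "coin_measure = PiM UNIV (\<lambda>_. measure_pmf (bernoulli_pmf (1/2)))"

text \<open>A set is identified with its characteristic function when measuring classes of sets.\<close>

definition null_class :: "nat set set \<Rightarrow> bool" where
  "null_class C \<longleftrightarrow> {f. {n. f n} \<in> C} \<in> null_sets coin_measure"

definition weakly_3_random_rel :: "nat set \<Rightarrow> nat set \<Rightarrow> bool" where
  "weakly_3_random_rel X Y \<longleftrightarrow> (\<forall>C. Pi03_class Y C \<and> null_class C \<longrightarrow> X \<notin> C)"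


section \<open>Basic facts\<close>

primrec subst_oracle :: "functional \<Rightarrow> functional \<Rightarrow> functional" where
  "subst_oracle \<Psi> Zero = Zero"
| "subst_oracle \<Psi> Succ = Succ"
| "subst_oracle \<Psi> Left = Left"
| "subst_oracle \<Psi> Right = Right"
| "subst_oracle \<Psi> Oracle = \<Psi>"
| "subst_oracle \<Psi> (Pairing f g) = Pairing (subst_oracle \<Psi> f) (subst_oracle \<Psi> g)"
| "subst_oracle \<Psi> (Comp f g) = Comp (subst_oracle \<Psi> f) (subst_oracle \<Psi> g)"
| "subst_oracle \<Psi> (PrimRec f g) = PrimRec (subst_oracle \<Psi> f) (subst_oracle \<Psi> g)"
| "subst_oracle \<Psi> (Mu f) = Mu (subst_oracle \<Psi> f)"

lemma run_subst_oracle: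
  assumes "computes_set \<Psi> B A"
  shows "run (subst_oracle \<Psi> \<Phi>) B = run \<Phi> A"
proof (induction \<Phi>)
  case Oracle
  then show ?case using assms by (simp add: fun_eq_iff computes_set_def)
qed (simp_all only: run.simps subst_oracle.simps fun_eq_iff, simp_all only: fun_eq_iff[symmetric])

lemma computes_set_subst_oracle:
  "computes_set \<Psi> B A \<Longrightarrow> computes_set (subst_oracle \<Psi> \<Phi>) B E \<longleftrightarrow> computes_set \<Phi> A E"
  by (drule run_subst_oracle[of _ _ _ \<Phi>]) (simp only: computes_set_def)

lemma turing_le_refl: "A \<le>\<^sub>T A"
proof -
  have "computes_set Oracle A A" by (simp add: computes_set_def)
  then show ?thesis unfolding turing_le_def by blast
qed

lemma turing_le_trans: "A \<le>\<^sub>T B \<Longrightarrow> B \<le>\<^sub>T C \<Longrightarrow> A \<le>\<^sub>T C"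
  unfolding turing_le_def using computes_set_subst_oracle by blast

lemma coarse_description_refl: "coarse_description X X"
  by (simp add: coarse_description_def has_density_def partial_density_def)

lemma uc_le_refl: "X \<le>\<^sub>u\<^sub>c X"
proof -
  have "computes_set Oracle D D" for D by (simp add: computes_set_def)
  then show ?thesis unfolding uc_le_def by blast
qed

lemma uc_le_trans:
  assumes "X \<le>\<^sub>u\<^sub>c Y" "Y \<le>\<^sub>u\<^sub>c Z"
  shows "X \<le>\<^sub>u\<^sub>c Z"
proof -
  obtain \<Phi> where \<Phi>:
    "\<And>D. coarse_description D Y \<Longrightarrow> \<exists>E. computes_set \<Phi> D E \<and> coarse_description E X"
    using assms(1) unfolding uc_le_def by blast
  obtain \<Psi> where \<Psi>:
    "\<And>D. coarse_description D Z \<Longrightarrow> \<exists>E. computes_set \<Psi> D E \<and> coarse_description E Y"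
    using assms(2) unfolding uc_le_def by blast
  have "\<exists>E. computes_set (subst_oracle \<Psi> \<Phi>) D E \<and> coarse_description E X"
    if "coarse_description D Z" for D
    using \<Psi>[OF that] \<Phi> computes_set_subst_oracle by blast
  then show ?thesis unfolding uc_le_def by blast
qed

lemma nc_le_refl: "X \<le>\<^sub>n\<^sub>c X"
  unfolding nc_le_def using turing_le_refl by blast

lemma nc_le_trans: "X \<le>\<^sub>n\<^sub>c Y \<Longrightarrow> Y \<le>\<^sub>n\<^sub>c Z \<Longrightarrow> X \<le>\<^sub>n\<^sub>c Z"
  unfolding nc_le_def using turing_le_trans by meson

lemma uc_le_imp_nc_le: "X \<le>\<^sub>u\<^sub>c Y \<Longrightarrow> X \<le>\<^sub>n\<^sub>c Y"
  unfolding uc_le_def nc_le_def turing_le_def by blast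

lemma coarsely_computable_imp_uc_le:
  assumes "coarsely_computable A"
  shows "A \<le>\<^sub>u\<^sub>c B"
proof -
  obtain \<Phi> E where \<Phi>: "computes_set \<Phi> {} E" and E: "coarse_description E A"
    using assms unfolding coarsely_computable_def computable_def turing_le_def by blast
  have "computes_set Zero D {}" for D by (simp add: computes_set_def)
  then have "computes_set (subst_oracle Zero \<Phi>) D E" for D
    using \<Phi> computes_set_subst_oracle by blast
  with E show ?thesis unfolding uc_le_def by blast
qed

lemma nc_le_empty_iff: "A \<le>\<^sub>n\<^sub>c {} \<longleftrightarrow> coarsely_computable A"
  using coarsely_computable_imp_uc_le uc_le_imp_nc_le coarse_description_refl
  unfolding nc_le_def coarsely_computable_def computable_def by meson

lemma uc_le_empty_iff: "A \<le>\<^sub>u\<^sub>c {} \<longleftrightarrow> coarsely_computable A"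
  using coarsely_computable_imp_uc_le uc_le_imp_nc_le nc_le_empty_iff by blast

lemma equiv_degree_equiv:
  assumes refl: "\<And>A. le A A" and trans: "\<And>A B C. le A B \<Longrightarrow> le B C \<Longrightarrow> le A C"
  shows "equiv UNIV (degree_equiv le)"
proof (rule equivI)
  show "refl_on UNIV (degree_equiv le)"
    using refl by (simp add: degree_equiv_def refl_on_def)
  show "sym (degree_equiv le)"
    by (simp add: degree_equiv_def sym_def)
  show "trans (degree_equiv le)"
  proof (rule transI)
    fix A B C
    assume "(A, B) \<in> degree_equiv le" "(B, C) \<in> degree_equiv le"
    then show "(A, C) \<in> degree_equiv le"
      using trans[of A B C] trans[of C B A] by (simp add: degree_equiv_def)
  qed
qed simp

lemma degree_of_in_degrees: "degree_of le A \<in> degrees le"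
  unfolding degree_of_def degrees_def by (rule quotientI) simp

lemma degrees_cases:
  assumes "a \<in> degrees le"
  obtains A where "a = degree_of le A"
  using assms unfolding degree_of_def degrees_def by (rule quotientE)

lemma mem_degree_of: "B \<in> degree_of le A \<longleftrightarrow> le A B \<and> le B A"
  by (simp add: degree_of_def degree_equiv_def)

lemma degree_le_degree_of_iff:
  assumes refl: "\<And>A. le A A" and trans: "\<And>A B C. le A B \<Longrightarrow> le B C \<Longrightarrow> le A C"
  shows "degree_le le (degree_of le A) (degree_of le B) \<longleftrightarrow> le A B"
proof
  assume "degree_le le (degree_of le A) (degree_of le B)"
  then obtain A' B' where 1: "le A A'" "le A' B'" "le B' B"
    unfolding degree_le_def by (auto simp only: mem_degree_of)
  show "le A B"
    by (rule trans[OF 1(1) trans[OF 1(2) 1(3)]])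
next
  assume "le A B"
  moreover have "A \<in> degree_of le A" "B \<in> degree_of le B"
    by (simp_all add: mem_degree_of refl)
  ultimately show "degree_le le (degree_of le A) (degree_of le B)"
    unfolding degree_le_def by fast
qed

lemma least_degree_iff_aux:
  assumes refl: "\<And>A. le A A" and trans: "\<And>A B C. le A B \<Longrightarrow> le B C \<Longrightarrow> le A C"
    and least: "\<And>A B. coarsely_computable A \<Longrightarrow> le A B"
    and empty: "\<And>A. le A {} \<longleftrightarrow> coarsely_computable A"
  shows "least_degree le a \<longleftrightarrow> a = {A. coarsely_computable A}"
proof -
  note le_iff = degree_le_degree_of_iff[of le, OF refl trans]
  have down: "coarsely_computable A" if "le A B" "coarsely_computable B" for A B
    using trans[OF that(1) least[OF that(2), of "{}"]] by (simp only: empty)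
  have eq: "degree_of le A = {A. coarsely_computable A}" if "coarsely_computable A" for A
  proof (intro set_eqI iffI)
    fix B assume "B \<in> degree_of le A"
    then have "le B A" by (simp add: mem_degree_of)
    then show "B \<in> {A. coarsely_computable A}" using down that by simp
  next
    fix B assume "B \<in> {A. coarsely_computable A}"
    then show "B \<in> degree_of le A" using least that by (simp add: mem_degree_of)
  qed
  have cc_empty: "coarsely_computable {}"
    using refl[of "{}"] by (simp only: empty)
  show ?thesis
  proof
    assume a: "least_degree le a"
    then have "a \<in> degrees le" by (simp add: least_degree_def)
    then obtain A where A: "a = degree_of le A" by (rule degrees_cases)
    have "degree_le le a (degree_of le {})"
      using a degree_of_in_degrees by (simp add: least_degree_def)
    then have "le A {}" unfolding A by (simp only: le_iff)
    then have "coarsely_computable A" by (simp only: empty)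
    then show "a = {A. coarsely_computable A}" using A eq by simp
  next
    assume "a = {A. coarsely_computable A}"
    then have a: "a = degree_of le {}" using eq[OF cc_empty] by simp
    have "degree_le le a b" if b: "b \<in> degrees le" for b
    proof -
      obtain B where "b = degree_of le B" using b by (rule degrees_cases)
      then show ?thesis using least[OF cc_empty, of B] unfolding a by (simp only: le_iff)
    qed
    then show "least_degree le a"
      unfolding least_degree_def using degree_of_in_degrees a by simp
  qed
qed

lemma least_nc_degree_iff: "least_degree nc_le a \<longleftrightarrow> a = {A. coarsely_computable A}"
  by (rule least_degree_iff_aux)
    (fact nc_le_refl, erule (1) nc_le_trans,
     erule uc_le_imp_nc_le[OF coarsely_computable_imp_uc_le], fact nc_le_empty_iff)

lemma least_uc_degree_iff: "least_degree uc_le a \<longleftrightarrow> a = {A. coarsely_computable A}"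
  by (rule least_degree_iff_aux)
    (fact uc_le_refl, erule (1) uc_le_trans,
     erule coarsely_computable_imp_uc_le, fact uc_le_empty_iff)

end

theory Submission
  imports Defs
begin

text \<open>
  Suppose \<open>\<Phi>\<^sup>X\<close> is a coarse description of \<open>A\<close>, where \<open>A\<close> is computable from \<open>Y\<close>.  The sets \<open>Z\<close>
  for which \<open>\<Phi>\<^sup>Z\<close> is a coarse description of \<open>A\<close> form a \<open>\<Pi>\<^sup>0\<^sub>3\<close> class relative to \<open>Y\<close>, which
  has positive measure because it contains \<open>X\<close>; so it fills more than \<open>3/4\<close> of some cylinder.
  A majority vote among the \<open>Z\<close> in this cylinder, taken as soon as \<open>\<Phi>\<^sup>Z(k)\<close> has converged on
  \<open>3/4\<close> of it, is computable.  It can only be wrong at \<open>k\<close> if a fixed proportion of the \<open>Z\<close> in the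
  class is wrong at \<open>k\<close>, and by dominated convergence such \<open>k\<close> have density \<open>0\<close>.  Hence \<open>A\<close> is
  coarsely computable.  The minimal pair property follows with \<open>A\<close> a \<open>Y\<close>-computable coarse
  description of a set below both \<open>X\<close> and \<open>Y\<close>.
\<close>

section \<open>Relative computability\<close>

abbreviation p1 :: "nat \<Rightarrow> nat" where "p1 z \<equiv> fst (prod_decode z)"
abbreviation p2 :: "nat \<Rightarrow> nat" where "p2 z \<equiv> snd (prod_decode z)"

definition computable_fun :: "nat set \<Rightarrow> (nat \<Rightarrow> nat) \<Rightarrow> bool" where
  "computable_fun A f \<longleftrightarrow> (\<exists>\<Phi>. \<forall>x. run \<Phi> A x = Some (f x))"

definition computable_pred :: "nat set \<Rightarrow> (nat \<Rightarrow> bool) \<Rightarrow> bool" where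
  "computable_pred A P \<longleftrightarrow> computable_fun A (\<lambda>x. of_bool (P x))"

lemma turing_le_iff_computable_pred: "B \<le>\<^sub>T A \<longleftrightarrow> computable_pred A (\<lambda>x. x \<in> B)"
  by (simp add: turing_le_def computes_set_def computable_pred_def computable_fun_def)

lemma computable_fun_id: "computable_fun A (\<lambda>x. x)"
  \<comment> \<open>No basic program is the identity; pairing the two projections restores the
    input.\<close>
  unfolding computable_fun_def by (rule exI[of _ "Pairing Left Right"]) simp

lemma computable_fun_comp:
  assumes "computable_fun A f" "computable_fun A g"
  shows "computable_fun A (\<lambda>x. f (g x))"
proof -
  obtain \<Phi> \<Psi> where "\<And>x. run \<Phi> A x = Some (f x)" "\<And>x. run \<Psi> A x = Some (g x)"
    using assms unfolding computable_fun_def by blast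
  then show ?thesis
    unfolding computable_fun_def by (intro exI[of _ "Comp \<Phi> \<Psi>"]) simp
qed

lemma computable_fun_Suc: "computable_fun A f \<Longrightarrow> computable_fun A (\<lambda>x. Suc (f x))"
  by (rule computable_fun_comp[of A Suc]) (auto simp: computable_fun_def intro: exI[of _ Succ])

lemma computable_fun_p1: "computable_fun A f \<Longrightarrow> computable_fun A (\<lambda>x. p1 (f x))"
  by (rule computable_fun_comp[of A p1]) (auto simp: computable_fun_def intro: exI[of _ Left])

lemma computable_fun_p2: "computable_fun A f \<Longrightarrow> computable_fun A (\<lambda>x. p2 (f x))"
  by (rule computable_fun_comp[of A p2]) (auto simp: computable_fun_def intro: exI[of _ Right])

lemma computable_fun_const: "computable_fun A (\<lambda>x. c)"
proof (induction c)
  case 0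
  show ?case by (auto simp: computable_fun_def intro: exI[of _ Zero])
qed (rule computable_fun_Suc)

lemma computable_fun_pair:
  assumes "computable_fun A f" "computable_fun A g"
  shows "computable_fun A (\<lambda>x. prod_encode (f x, g x))"
proof -
  obtain \<Phi> \<Psi> where "\<And>x. run \<Phi> A x = Some (f x)" "\<And>x. run \<Psi> A x = Some (g x)"
    using assms unfolding computable_fun_def by blast
  then show ?thesis
    unfolding computable_fun_def by (intro exI[of _ "Pairing \<Phi> \<Psi>"]) simp
qed

lemma computable_pred_oracle:
  assumes "computable_fun A f"
  shows "computable_pred A (\<lambda>x. f x \<in> A)"
  unfolding computable_pred_def
  by (rule computable_fun_comp[OF _ assms]) (auto simp: computable_fun_def intro: exI[of _ Oracle])

text \<open>\<open>PrimRec\<close> recurses on the second component of its input, so it is applied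
  to the pair of \<open>x\<close> and \<open>h x\<close>; start and step then both see
  \<open>x\<close> as the parameter. The step receives its three arguments as one nested
  pair.\<close>

lemma computable_fun_rec_nat:
  assumes "computable_fun A f"
    and "computable_fun A (\<lambda>z. g (p1 z) (p1 (p2 z)) (p2 (p2 z)))"
    and "computable_fun A h"
  shows "computable_fun A (\<lambda>x. rec_nat (f x) (g x) (h x))"
proof -
  obtain \<Phi> \<Psi> where \<Phi>: "\<And>x. run \<Phi> A x = Some (f x)"
    and \<Psi>: "\<And>z. run \<Psi> A z = Some (g (p1 z) (p1 (p2 z)) (p2 (p2 z)))"
    using assms unfolding computable_fun_def by blast
  have "run (PrimRec \<Phi> \<Psi>) A z = Some (rec_nat (f (p1 z)) (g (p1 z)) (p2 z))" for z
  proof -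
    have "rec_nat (Some (f p)) (\<lambda>k r. Option.bind r (\<lambda>v. Some (g p k v))) n
        = Some (rec_nat (f p) (g p) n)" for p n
      by (induction n) auto
    then show ?thesis by (simp add: \<Phi> \<Psi> split_def Let_def)
  qed
  then have "computable_fun A (\<lambda>z. rec_nat (f (p1 z)) (g (p1 z)) (p2 z))"
    unfolding computable_fun_def by blast
  from computable_fun_comp[OF this computable_fun_pair[OF computable_fun_id assms(3)]]
  show ?thesis by simp
qed

named_theorems computability

lemmas [computability] = computable_fun_id computable_fun_const computable_fun_Suc
  computable_fun_p1 computable_fun_p2 computable_fun_pair computable_pred_oracle

lemma computable_fun_add [computability]:
  assumes "computable_fun A f" "computable_fun A g"
  shows "computable_fun A (\<lambda>x. f x + g x)"
proof -
  have "computable_fun A (\<lambda>x. rec_nat (f x) (\<lambda>k. Suc) (g x))"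
    by (intro computable_fun_rec_nat assms computability)
  moreover have "rec_nat a (\<lambda>k. Suc) b = a + b" for a b
    by (induction b) auto
  ultimately show ?thesis by simp
qed

lemma computable_fun_mult [computability]:
  assumes "computable_fun A f" "computable_fun A g"
  shows "computable_fun A (\<lambda>x. f x * g x)"
proof -
  have "computable_fun A (\<lambda>x. rec_nat 0 (\<lambda>k r. r + f x) (g x))"
    by (intro computable_fun_rec_nat assms computability computable_fun_comp[OF assms(1)])
  moreover have "rec_nat 0 (\<lambda>k r. r + a) b = a * b" for a b :: nat
    by (induction b) auto
  ultimately show ?thesis by simp
qed

lemma computable_fun_power [computability]:
  assumes "computable_fun A f" "computable_fun A g"
  shows "computable_fun A (\<lambda>x. f x ^ g x)"
proof -
  have "computable_fun A (\<lambda>x. rec_nat 1 (\<lambda>k r. r * f x) (g x))"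
    by (intro computable_fun_rec_nat assms computability computable_fun_comp[OF assms(1)])
  moreover have "rec_nat 1 (\<lambda>k r. r * a) b = a ^ b" for a b :: nat
    by (induction b) auto
  ultimately show ?thesis by simp
qed

lemma computable_fun_pred:
  assumes "computable_fun A f"
  shows "computable_fun A (\<lambda>x. f x - 1)"
proof -
  have "computable_fun A (\<lambda>x. rec_nat 0 (\<lambda>k r. k) (f x))"
    by (intro computable_fun_rec_nat assms computability)
  moreover have "rec_nat 0 (\<lambda>k r. k) b = b - 1" for b :: nat
    by (cases b) auto
  ultimately show ?thesis by simp
qed

lemma computable_fun_diff [computability]:
  assumes "computable_fun A f" "computable_fun A g"
  shows "computable_fun A (\<lambda>x. f x - g x)"
proof -
  have "computable_fun A (\<lambda>x. rec_nat (f x) (\<lambda>k r. r - 1) (g x))"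
    by (intro computable_fun_rec_nat assms computability computable_fun_pred)
  moreover have "rec_nat a (\<lambda>k r. r - 1) b = a - b" for a b :: nat
    by (induction b) auto
  ultimately show ?thesis by simp
qed

lemma computable_pred_le [computability]:
  assumes "computable_fun A f" "computable_fun A g"
  shows "computable_pred A (\<lambda>x. f x \<le> g x)"
proof -
  \<comment> \<open>Subtraction is truncated: \<open>f x - g x\<close> vanishes exactly when
    \<open>f x \<le> g x\<close>.\<close>
  have "computable_fun A (\<lambda>x. 1 - (f x - g x))"
    by (intro assms computability)
  moreover have "1 - (a - b) = of_bool (a \<le> b)" for a b :: nat
    by auto
  ultimately show ?thesis by (simp add: computable_pred_def)
qed

lemma computable_pred_not [computability]:
  assumes "computable_pred A P"
  shows "computable_pred A (\<lambda>x. \<not> P x)"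
proof -
  have "computable_fun A (\<lambda>x. 1 - of_bool (P x))"
    by (intro assms[unfolded computable_pred_def] computability)
  moreover have "1 - of_bool p = (of_bool (\<not> p) :: nat)" for p
    by auto
  ultimately show ?thesis by (simp only: computable_pred_def)
qed

lemma computable_pred_conj [computability]:
  assumes "computable_pred A P" "computable_pred A Q"
  shows "computable_pred A (\<lambda>x. P x \<and> Q x)"
proof -
  have "computable_fun A (\<lambda>x. of_bool (P x) * of_bool (Q x))"
    by (intro assms[unfolded computable_pred_def] computability)
  then show ?thesis by (simp add: computable_pred_def of_bool_conj)
qed

lemma computable_pred_disj [computability]:
  assumes "computable_pred A P" "computable_pred A Q"
  shows "computable_pred A (\<lambda>x. P x \<or> Q x)"
proof -
  have "computable_pred A (\<lambda>x. \<not> (\<not> P x \<and> \<not> Q x))"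
    by (intro assms computability)
  then show ?thesis by simp
qed

lemma computable_pred_imp [computability]:
  assumes "computable_pred A P" "computable_pred A Q"
  shows "computable_pred A (\<lambda>x. P x \<longrightarrow> Q x)"
proof -
  have "computable_pred A (\<lambda>x. \<not> P x \<or> Q x)"
    by (intro assms computability)
  then show ?thesis by (simp only: imp_conv_disj)
qed

lemma computable_pred_iff [computability]:
  assumes "computable_pred A P" "computable_pred A Q"
  shows "computable_pred A (\<lambda>x. P x = Q x)"
proof -
  have "computable_pred A (\<lambda>x. (P x \<longrightarrow> Q x) \<and> (Q x \<longrightarrow> P x))"
    by (intro assms computability)
  then show ?thesis by (simp only: iff_conv_conj_imp)
qed

lemma computable_pred_less [computability]:
  assumes "computable_fun A f" "computable_fun A g"
  shows "computable_pred A (\<lambda>x. f x < g x)"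
  unfolding Suc_le_eq[symmetric] by (intro assms computability)

lemma computable_pred_eq [computability]:
  assumes "computable_fun A f" "computable_fun A g"
  shows "computable_pred A (\<lambda>x. f x = g x)"
  unfolding order_eq_iff by (intro assms computability)

lemma computable_fun_of_bool [computability]:
  "computable_pred A P \<Longrightarrow> computable_fun A (\<lambda>x. of_bool (P x))"
  by (simp add: computable_pred_def)

lemma computable_pred_comp:
  assumes "computable_pred A P" "computable_fun A g"
  shows "computable_pred A (\<lambda>x. P (g x))"
  using computable_fun_comp[OF assms(1)[unfolded computable_pred_def] assms(2)]
  by (simp add: computable_pred_def)

lemma computable_fun_if [computability]:
  assumes "computable_pred A P" "computable_fun A f" "computable_fun A g"
  shows "computable_fun A (\<lambda>x. if P x then f x else g x)"
proof -
  have "computable_fun A (\<lambda>x. of_bool (P x) * f x + of_bool (\<not> P x) * g x)"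
    by (intro assms computability)
  moreover have "of_bool p * a + of_bool (\<not> p) * b = (if p then a else b)" for p and a b :: nat
    by auto
  ultimately show ?thesis by simp
qed

text \<open>Bounded quantifiers and bounded counting are derived below from sums of truth values.
  The summation index is passed paired with the outer argument, hence \<open>p1 z\<close> and
  \<open>p2 z\<close> in the premise.\<close>

lemma computable_fun_sum [computability]:
  assumes "computable_fun A (\<lambda>z. g (p1 z) (p2 z))" "computable_fun A h"
  shows "computable_fun A (\<lambda>x. \<Sum>k<h x. g x k)"
proof -
  have "computable_fun A (\<lambda>z. g (p1 z) (p1 (p2 z)))"
    using computable_fun_comp[OF assms(1), of "\<lambda>z. prod_encode (p1 z, p1 (p2 z))"]
    by (simp add: computability)
  then have "computable_fun A (\<lambda>x. rec_nat 0 (\<lambda>k r. r + g x k) (h x))"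
    by (intro computable_fun_rec_nat assms computability)
  moreover have "rec_nat 0 (\<lambda>k r. r + u k) b = (\<Sum>k<b. u k)" for u :: "nat \<Rightarrow> nat" and b
    by (induction b) auto
  ultimately show ?thesis by simp
qed

lemma computable_pred_bex [computability]:
  assumes "computable_pred A (\<lambda>z. P (p1 z) (p2 z))" "computable_fun A h"
  shows "computable_pred A (\<lambda>x. \<exists>k<h x. P x k)"
proof -
  have "computable_pred A (\<lambda>x. 1 \<le> (\<Sum>k<h x. of_bool (P x k) :: nat))"
    by (intro assms computability)
  moreover have "1 \<le> (\<Sum>k<n. of_bool (u k) :: nat) \<longleftrightarrow> (\<exists>k<n. u k)" for u and n :: nat
    by (auto simp: Suc_le_eq simp flip: neq0_conv)
  ultimately show ?thesis by simp
qed

lemma computable_pred_ball [computability]: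
  assumes "computable_pred A (\<lambda>z. P (p1 z) (p2 z))" "computable_fun A h"
  shows "computable_pred A (\<lambda>x. \<forall>k<h x. P x k)"
proof -
  have "computable_pred A (\<lambda>x. \<not> (\<exists>k<h x. \<not> P x k))"
    by (intro assms computability)
  then show ?thesis by simp
qed

lemma computable_fun_card [computability]:
  assumes "computable_pred A (\<lambda>z. P (p1 z) (p2 z))" "computable_fun A h"
  shows "computable_fun A (\<lambda>x. card {k. k < h x \<and> P x k})"
proof -
  have "computable_fun A (\<lambda>x. \<Sum>k<h x. of_bool (P x k))"
    by (intro assms computability)
  moreover have "(\<Sum>k<n. of_bool (u k)) = card {k. k < n \<and> u k}" for u and n :: nat
    by (simp add: sum.If_cases of_bool_def lessThan_def Int_def)
  ultimately show ?thesis by simp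
qed

lemma computable_fun_Least:
  assumes P: "computable_pred A (\<lambda>z. P (p1 z) (p2 z))" and ex: "\<And>x. \<exists>n. P x n"
  shows "computable_fun A (\<lambda>x. LEAST n. P x n)"
proof -
  \<comment> \<open>\<open>Mu\<close> looks for a zero and zero codes falsity, so the negation is
    computed. It is total, which settles the demand that all earlier values converge.\<close>
  have "computable_fun A (\<lambda>z. of_bool (\<not> P (p1 z) (p2 z)))"
    by (intro P computability)
  then obtain \<Phi> where \<Phi>: "\<And>z. run \<Phi> A z = Some (of_bool (\<not> P (p1 z) (p2 z)))"
    unfolding computable_fun_def by blast
  have "run (Mu \<Phi>) A x = Some (LEAST n. P x n)" for x
    using ex[of x] by (simp add: \<Phi>)
  then show ?thesis unfolding computable_fun_def by blast
qed

text \<open>The quotient is found by searching for the least \<open>q\<close> with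
  \<open>f x < g x * Suc q\<close>; positivity of \<open>g x\<close> makes the search
  terminate.\<close>

lemma computable_fun_div [computability]:
  assumes "computable_fun A f" "computable_fun A g" and pos: "\<And>x. g x > 0"
  shows "computable_fun A (\<lambda>x. f x div g x)"
proof -
  have ex: "\<exists>q. f x < g x * Suc q" for x
    using dividend_less_times_div[OF pos[of x]] by (metis mult_Suc_right)
  have eq: "(LEAST q. f x < g x * Suc q) = f x div g x" for x
  proof (rule Least_equality)
    show "f x < g x * Suc (f x div g x)"
      using dividend_less_times_div[OF pos[of x]] by simp
  next
    fix q assume "f x < g x * Suc q"
    then have "f x div g x < Suc q"
      by (simp add: less_mult_imp_div_less mult.commute)
    then show "f x div g x \<le> q" by simp
  qed
  have "computable_pred A (\<lambda>z. f (p1 z) < g (p1 z) * Suc (p2 z))"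
    by (intro computability computable_fun_comp[OF assms(1)] computable_fun_comp[OF assms(2)])
  then have "computable_fun A (\<lambda>x. LEAST q. f x < g x * Suc q)"
    by (rule computable_fun_Least) (rule ex)
  then show ?thesis by (simp only: eq)
qed

lemma computable_pred_set_decode [computability]:
  assumes "computable_fun A f" "computable_fun A g"
  shows "computable_pred A (\<lambda>x. f x \<in> set_decode (g x))"
proof -
  \<comment> \<open>A binary digit is the parity of the shifted number, and parity is tested by
    halving and doubling.\<close>
  have "computable_pred A (\<lambda>x. 2 * (g x div 2 ^ f x div 2) \<noteq> g x div 2 ^ f x)"
    by (intro computability assms) auto
  moreover have "2 * (n div 2) \<noteq> n \<longleftrightarrow> odd n" for n :: nat
    by (metis dvd_triv_left dvd_mult_div_cancel)
  ultimately show ?thesis by (simp add: set_decode_def)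
qed

section \<open>Decoding strings from their list codes\<close>

text \<open>Iterating the tail function on \<^term>\<open>list_encode xs\<close> gives access to the entries of \<^term>\<open>xs\<close>.\<close>

definition code_drop :: "nat \<Rightarrow> nat \<Rightarrow> nat" where
  "code_drop c i = rec_nat c (\<lambda>_ r. p2 (r - 1)) i"

lemma computable_fun_code_drop [computability]:
  assumes "computable_fun A f" "computable_fun A g"
  shows "computable_fun A (\<lambda>x. code_drop (f x) (g x))"
  unfolding code_drop_def by (intro computable_fun_rec_nat assms computability)

text \<open>Together with \<open>0 - 1 = 0\<close> this makes the code 0 of the empty list a fixed
  point of the tail function, so dropping beyond the end is harmless.\<close>

lemma p2_0: "p2 0 = 0"
proof -
  have "prod_encode (0, 0) = 0" by (simp add: prod_encode_def)
  then show ?thesis by (metis prod_encode_inverse snd_conv)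
qed

lemma code_drop_list_encode: "code_drop (list_encode xs) i = list_encode (drop i xs)"
proof (induction i)
  case (Suc i)
  have "code_drop c (Suc i) = p2 (code_drop c i - 1)" for c
    by (simp add: code_drop_def)
  moreover have "p2 (list_encode ys - 1) = list_encode (tl ys)" for ys
    by (cases ys) (simp_all add: p2_0)
  ultimately show ?case
    using Suc by (simp add: drop_Suc tl_drop)
qed (simp add: code_drop_def)

text \<open>Every index inside the list leaves a nonempty remainder, whose code is nonzero. A list
  is no longer than its code, so the count may be cut off at \<open>c\<close>, which makes it a
  bounded count.\<close>

definition code_length :: "nat \<Rightarrow> nat" where
  "code_length c = card {i. i < c \<and> code_drop c i \<noteq> 0}"

text \<open>Subtracting 1 undoes the successor in \<open>list_encode\<close>, and the first
  component is then the entry at position \<open>i\<close>. Beyond the end this yields 0, so such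
  positions are absent.\<close>

definition code_set :: "nat \<Rightarrow> nat set" where
  "code_set c = {i. p1 (code_drop c i - 1) = 1}"

lemma computable_fun_code_length [computability]:
  "computable_fun A f \<Longrightarrow> computable_fun A (\<lambda>x. code_length (f x))"
  by (rule computable_fun_comp[of A code_length])
    (unfold code_length_def, intro computability)

lemma computable_pred_code_set [computability]:
  assumes "computable_fun A f" "computable_fun A g"
  shows "computable_pred A (\<lambda>x. f x \<in> code_set (g x))"
  unfolding code_set_def mem_Collect_eq by (intro assms computability)

lemma length_le_list_encode: "length xs \<le> list_encode xs"
proof (induction xs)
  case (Cons x xs)
  then show ?case using le_prod_encode_2[of "list_encode xs" x] by simp
qed simp

lemma code_length_list_encode: "code_length (list_encode xs) = length xs"
proof -
  have "list_encode ys = 0 \<longleftrightarrow> ys = []" for ys by (cases ys) auto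
  then have "code_drop (list_encode xs) i \<noteq> 0 \<longleftrightarrow> i < length xs" for i
    by (simp add: code_drop_list_encode not_le)
  then have "{i. i < list_encode xs \<and> code_drop (list_encode xs) i \<noteq> 0} = {..<length xs}"
    using length_le_list_encode[of xs] by (simp only: lessThan_def) (metis (lifting) less_le_trans)
  then show ?thesis by (simp only: code_length_def card_lessThan)
qed

lemma code_length_initial_segment: "code_length (initial_segment X n) = n"
  by (simp add: initial_segment_def code_length_list_encode)

lemma code_set_initial_segment: "i < n \<Longrightarrow> i \<in> code_set (initial_segment X n) \<longleftrightarrow> i \<in> X"
  by (simp add: initial_segment_def code_set_def code_drop_list_encode Cons_nth_drop_Suc[symmetric])

section \<open>Evaluation with bounded use and search\<close>

text \<open>
  \<open>s\<close> bounds the oracle queries and the searches, so that the value depends only on the first \<open>s\<close>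
  bits of the oracle.
\<close>

primrec bounded_run :: "functional \<Rightarrow> nat \<Rightarrow> nat set \<Rightarrow> nat \<Rightarrow> nat option" where
  "bounded_run Zero s A x = Some 0"
| "bounded_run Succ s A x = Some (Suc x)"
| "bounded_run Left s A x = Some (p1 x)"
| "bounded_run Right s A x = Some (p2 x)"
| "bounded_run Oracle s A x = (if x < s then Some (of_bool (x \<in> A)) else None)"
| "bounded_run (Pairing f g) s A x =
     Option.bind (bounded_run f s A x) (\<lambda>u. Option.bind (bounded_run g s A x) (\<lambda>v. Some (prod_encode (u, v))))"
| "bounded_run (Comp f g) s A x = Option.bind (bounded_run g s A x) (bounded_run f s A)"
| "bounded_run (PrimRec f g) s A x =
     rec_nat (bounded_run f s A (p1 x))
        (\<lambda>k r. Option.bind r (\<lambda>v. bounded_run g s A (prod_encode (p1 x, prod_encode (k, v))))) (p2 x)"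
| "bounded_run (Mu f) s A x =
     (if \<exists>n<s. bounded_run f s A (prod_encode (x, n)) = Some 0 \<and> (\<forall>m<n. bounded_run f s A (prod_encode (x, m)) \<noteq> None)
      then Some (LEAST n. bounded_run f s A (prod_encode (x, n)) = Some 0)
      else None)"

lemma bounded_run_cong:
  assumes "\<And>i. i < s \<Longrightarrow> i \<in> A \<longleftrightarrow> i \<in> B"
  shows "bounded_run \<Phi> s A = bounded_run \<Phi> s B"
proof (induction \<Phi>)
  case Oracle
  then show ?case using assms by (simp add: fun_eq_iff)
qed (simp_all only: bounded_run.simps fun_eq_iff, simp_all only: fun_eq_iff[symmetric])

text \<open>\<open>F\<close> and \<open>G\<close> are two stages of the search in \<^const>\<open>Mu\<close>, of which \<open>G\<close> is the later one.\<close>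

lemma least_Some_eqI:
  fixes n :: nat
  assumes "F n = Some 0" "\<And>m. m < n \<Longrightarrow> F m \<noteq> None"
    and "\<And>m v. F m = Some v \<Longrightarrow> G m = Some v"
  shows "(LEAST n. G n = Some 0) = (LEAST n. F n = Some (0::nat))"
proof (rule Least_equality)
  have least: "F (LEAST n. F n = Some 0) = Some 0"
    by (rule LeastI) (rule assms(1))
  then show "G (LEAST n. F n = Some 0) = Some 0" by (rule assms(3))
  fix y assume y: "G y = Some 0"
  show "(LEAST n. F n = Some 0) \<le> y"
  proof (rule ccontr)
    assume "\<not> ?thesis"
    then have lt: "y < (LEAST n. F n = Some 0)" by simp
    moreover have "(LEAST n. F n = Some 0) \<le> n" by (rule Least_le) (rule assms(1))
    ultimately obtain v where "F y = Some v" using assms(2)[of y] by auto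
    with assms(3)[of y v] y have "F y = Some 0" by simp
    with lt show False using not_less_Least by blast
  qed
qed

text \<open>The delicate case is \<open>Mu\<close>, where a larger stage might reveal a smaller
  zero. Its clause demands that all values before the zero have converged, and converged values
  persist, so \<open>least_Some_eqI\<close> applies.\<close>

lemma bounded_run_mono: "bounded_run \<Phi> s A x = Some v \<Longrightarrow> s \<le> t \<Longrightarrow> bounded_run \<Phi> t A x = Some v"
proof (induction \<Phi> arbitrary: x v)
  case (PrimRec f g)
  have "rec_nat (bounded_run f s A p) (\<lambda>k r. Option.bind r (\<lambda>v. bounded_run g s A (prod_encode (p, prod_encode (k, v))))) n = Some v \<Longrightarrow>
        rec_nat (bounded_run f t A p) (\<lambda>k r. Option.bind r (\<lambda>v. bounded_run g t A (prod_encode (p, prod_encode (k, v))))) n = Some v" for p n v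
    by (induction n arbitrary: v) (auto simp: bind_eq_Some_conv PrimRec)
  then show ?case using PrimRec.prems by simp
next
  case (Mu f)
  from Mu.prems obtain n where n: "n < s" "bounded_run f s A (prod_encode (x, n)) = Some 0"
      "\<forall>m<n. bounded_run f s A (prod_encode (x, m)) \<noteq> None"
    and v: "v = (LEAST n. bounded_run f s A (prod_encode (x, n)) = Some 0)"
    by (auto split: if_splits)
  have mono: "bounded_run f s A z = Some w \<Longrightarrow> bounded_run f t A z = Some w" for z w
    using Mu by blast
  have "(LEAST n. bounded_run f t A (prod_encode (x, n)) = Some 0) = v"
    unfolding v using n mono by (intro least_Some_eqI) auto
  moreover have "n < t \<and> bounded_run f t A (prod_encode (x, n)) = Some 0 \<and> (\<forall>m<n. bounded_run f t A (prod_encode (x, m)) \<noteq> None)"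
    using n mono Mu.prems(2) by fastforce
  ultimately show ?case by auto
qed (fastforce simp: bind_eq_Some_conv split: if_splits)+

text \<open>The argument is that of \<open>bounded_run_mono\<close>, with the unbounded
  \<open>run\<close> in the role of the later stage.\<close>

lemma bounded_run_sound: "bounded_run \<Phi> s A x = Some v \<Longrightarrow> run \<Phi> A x = Some v"
proof (induction \<Phi> arbitrary: x v)
  case (PrimRec f g)
  have "rec_nat (bounded_run f s A p) (\<lambda>k r. Option.bind r (\<lambda>v. bounded_run g s A (prod_encode (p, prod_encode (k, v))))) n = Some v \<Longrightarrow>
        rec_nat (run f A p) (\<lambda>k r. Option.bind r (\<lambda>v. run g A (prod_encode (p, prod_encode (k, v))))) n = Some v" for p n v
    by (induction n arbitrary: v) (auto simp: bind_eq_Some_conv PrimRec)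
  then show ?case using PrimRec.prems by (simp add: split_def Let_def)
next
  case (Mu f)
  from Mu.prems obtain n where n: "bounded_run f s A (prod_encode (x, n)) = Some 0"
      "\<forall>m<n. bounded_run f s A (prod_encode (x, m)) \<noteq> None"
    and v: "v = (LEAST n. bounded_run f s A (prod_encode (x, n)) = Some 0)"
    by (auto split: if_splits)
  have "(LEAST n. run f A (prod_encode (x, n)) = Some 0) = v"
    unfolding v using n Mu.IH by (intro least_Some_eqI) auto
  moreover have "run f A (prod_encode (x, n)) = Some 0 \<and> (\<forall>m<n. run f A (prod_encode (x, m)) \<noteq> None)"
    using n Mu.IH by fastforce
  ultimately show ?case by auto
qed (fastforce simp: bind_eq_Some_conv split: if_splits)+

text \<open>A halting computation consists of finitely many subcomputations, and monotonicity allows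
  all of them to be carried out at one common stage.\<close>

lemma bounded_run_complete: "run \<Phi> A x = Some v \<Longrightarrow> \<exists>s. bounded_run \<Phi> s A x = Some v"
proof (induction \<Phi> arbitrary: x v)
  case (Pairing f g)
  from Pairing.prems obtain a b where ab: "run f A x = Some a" "run g A x = Some b" "v = prod_encode (a, b)"
    by (auto simp: bind_eq_Some_conv)
  obtain s t where "bounded_run f s A x = Some a" "bounded_run g t A x = Some b"
    using Pairing.IH ab by blast
  then have "bounded_run f (max s t) A x = Some a" "bounded_run g (max s t) A x = Some b"
    by (auto elim: bounded_run_mono)
  with ab show ?case by (intro exI[of _ "max s t"]) simp
next
  case (Comp f g)
  from Comp.prems obtain a where ab: "run g A x = Some a" "run f A a = Some v"
    by (auto simp: bind_eq_Some_conv)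
  obtain s t where "bounded_run g s A x = Some a" "bounded_run f t A a = Some v"
    using Comp.IH ab by blast
  then have "bounded_run g (max s t) A x = Some a" "bounded_run f (max s t) A a = Some v"
    by (auto elim: bounded_run_mono)
  then show ?case by (intro exI[of _ "max s t"]) simp
next
  case (PrimRec f g)
  have "rec_nat (run f A p) (\<lambda>k r. Option.bind r (\<lambda>v. run g A (prod_encode (p, prod_encode (k, v))))) n = Some v \<Longrightarrow>
        \<exists>s. bounded_run (PrimRec f g) s A (prod_encode (p, n)) = Some v" for p n v
  proof (induction n arbitrary: v)
    case 0
    then show ?case using PrimRec.IH by auto
  next
    case (Suc n)
    then obtain a where a: "rec_nat (run f A p) (\<lambda>k r. Option.bind r (\<lambda>v. run g A (prod_encode (p, prod_encode (k, v))))) n = Some a"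
      "run g A (prod_encode (p, prod_encode (n, a))) = Some v"
      by (auto simp: bind_eq_Some_conv)
    obtain s t where "bounded_run (PrimRec f g) s A (prod_encode (p, n)) = Some a"
        "bounded_run g t A (prod_encode (p, prod_encode (n, a))) = Some v"
      using Suc.IH a PrimRec.IH by blast
    then have "bounded_run (PrimRec f g) (max s t) A (prod_encode (p, n)) = Some a"
        "bounded_run g (max s t) A (prod_encode (p, prod_encode (n, a))) = Some v"
      by (auto elim: bounded_run_mono simp del: bounded_run.simps)
    then show ?case by (intro exI[of _ "max s t"]) simp
  qed
  from this[of "p1 x" "p2 x" v] show ?case using PrimRec.prems by (simp add: split_def Let_def del: bounded_run.simps)
next
  case (Mu f)
  from Mu.prems obtain n where n: "run f A (prod_encode (x, n)) = Some 0"
      "\<forall>m<n. run f A (prod_encode (x, m)) \<noteq> None"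
    by (auto split: if_splits)
  have "\<exists>s. bounded_run f s A (prod_encode (x, m)) \<noteq> None" if "m \<le> n" for m
  proof -
    have "m < n \<or> m = n" using that by auto
    with n have "run f A (prod_encode (x, m)) \<noteq> None" by auto
    then obtain v where "run f A (prod_encode (x, m)) = Some v" by blast
    then show ?thesis using Mu.IH by fastforce
  qed
  then obtain S where S: "\<And>m. m \<le> n \<Longrightarrow> bounded_run f (S m) A (prod_encode (x, m)) \<noteq> None"
    by metis
  \<comment> \<open>The sum exceeds every single stage \<open>S m\<close>, and \<open>Suc n\<close>
    brings the zero \<open>n\<close> within the search bound.\<close>
  define s where "s = Suc n + (\<Sum>m\<le>n. S m)"
  have conv: "\<exists>w. bounded_run f s A (prod_encode (x, m)) = Some w" if "m \<le> n" for m
  proof -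
    have "S m \<le> (\<Sum>m\<le>n. S m)" using that by (intro member_le_sum) auto
    then have "S m \<le> s" by (simp add: s_def)
    then show ?thesis using S[OF that] by (auto elim: bounded_run_mono)
  qed
  have "bounded_run f s A (prod_encode (x, n)) = Some 0" using conv[of n] bounded_run_sound n(1) by fastforce
  moreover have "bounded_run f s A (prod_encode (x, m)) \<noteq> None" if "m < n" for m
    using conv[of m] that by auto
  moreover have "n < s" by (simp add: s_def)
  ultimately have "\<exists>n<s. bounded_run f s A (prod_encode (x, n)) = Some 0 \<and> (\<forall>m<n. bounded_run f s A (prod_encode (x, m)) \<noteq> None)"
    by blast
  then obtain w where "bounded_run (Mu f) s A x = Some w"
    by (simp only: bounded_run.simps if_True)
  \<comment> \<open>Soundness identifies the value found with \<open>v\<close>, without a comparison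
    of the two minima.\<close>
  moreover from bounded_run_sound[OF this] Mu.prems have "w = v" by simp
  ultimately show ?case by blast
next
  case Oracle
  then show ?case by (auto intro: exI[of _ "Suc x"])
qed auto

definition option_code :: "nat option \<Rightarrow> nat" where
  "option_code r = (case r of None \<Rightarrow> 0 | Some v \<Rightarrow> Suc v)"

lemma option_code_simps [simp]:
  "option_code None = 0" "option_code (Some v) = Suc v"
  by (simp_all add: option_code_def)

text \<open>The oracle \<open>Z z\<close> of the simulated program is a parameter depending on the
  input, not the oracle \<open>A\<close> of the simulation. This allows simulations on oracles
  decoded from numbers, both for initial segments and for the count over all strings of a given
  length.\<close>

lemma computable_fun_bounded_run:
  assumes "computable_fun A s" "computable_fun A x" "computable_pred A (\<lambda>z. p2 z \<in> Z (p1 z))"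
  shows "computable_fun A (\<lambda>z. option_code (bounded_run \<Phi> (s z) (Z z) (x z)))"
  using assms
proof (induction \<Phi> arbitrary: s x Z)
  case Zero
  then show ?case by (simp add: computability)
next
  case Succ
  then show ?case by (simp add: computability)
next
  case Left
  then show ?case by (simp add: computability)
next
  case Right
  then show ?case by (simp add: computability)
next
  case Oracle
  have "computable_pred A (\<lambda>z. x z \<in> Z z)"
    using computable_pred_comp[OF Oracle(3), of "\<lambda>z. prod_encode (z, x z)"] Oracle(2)
    by (simp add: computability)
  then have "computable_fun A (\<lambda>z. if x z < s z then Suc (of_bool (x z \<in> Z z)) else 0)"
    using Oracle by (intro computability)
  then show ?case by (simp add: if_distrib[of option_code] cong: if_cong)
next
  case (Pairing f g)
  let ?f = "\<lambda>z. option_code (bounded_run f (s z) (Z z) (x z))" and ?g = "\<lambda>z. option_code (bounded_run g (s z) (Z z) (x z))"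
  have "computable_fun A ?f" "computable_fun A ?g"
    using Pairing by auto
  then have "computable_fun A (\<lambda>z. if ?f z = 0 then 0 else if ?g z = 0 then 0 else
      Suc (prod_encode (?f z - 1, ?g z - 1)))"
    by (intro computability)
  moreover have "option_code (bounded_run (Pairing f g) (s z) (Z z) (x z)) = (if ?f z = 0 then 0 else if ?g z = 0 then 0 else
      Suc (prod_encode (?f z - 1, ?g z - 1)))" for z
    by (auto simp: option_code_def split: option.splits)
  ultimately show ?case by simp
next
  case (Comp f g)
  let ?g = "\<lambda>z. option_code (bounded_run g (s z) (Z z) (x z))"
  have g: "computable_fun A ?g" using Comp by auto
  then have "computable_fun A (\<lambda>z. ?g z - 1)" by (intro computability)
  with Comp have "computable_fun A (\<lambda>z. option_code (bounded_run f (s z) (Z z) (?g z - 1)))"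
    by blast
  with g have "computable_fun A (\<lambda>z. if ?g z = 0 then 0 else option_code (bounded_run f (s z) (Z z) (?g z - 1)))"
    by (intro computability)
  moreover have "option_code (bounded_run (Comp f g) (s z) (Z z) (x z)) = (if ?g z = 0 then 0 else option_code (bounded_run f (s z) (Z z) (?g z - 1)))" for z
    by (auto simp: option_code_def split: option.splits)
  ultimately show ?case by simp
next
  case (PrimRec f g)
  have "computable_fun A (\<lambda>z. p1 (x z))" using PrimRec by (intro computability)
  then have f: "computable_fun A (\<lambda>z. option_code (bounded_run f (s z) (Z z) (p1 (x z))))"
    using PrimRec by blast
  \<comment> \<open>The step program runs on nested pairs whose first component is the original
    input, so the simulated oracle is read off that component.\<close>
  have Z: "computable_pred A (\<lambda>z. p2 z \<in> Z (p1 (p1 z)))"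
    using computable_pred_comp[OF PrimRec.prems(3), of "\<lambda>z. prod_encode (p1 (p1 z), p2 z)"]
    by (simp add: computability)
  let ?g = "\<lambda>z k r. option_code (bounded_run g (s z) (Z z) (prod_encode (p1 (x z), prod_encode (k, r - 1))))"
  have "computable_fun A (\<lambda>z. ?g (p1 z) (p1 (p2 z)) (p2 (p2 z)))"
    by (intro PrimRec.IH(2) computability computable_fun_comp[OF PrimRec.prems(1)]
       computable_fun_comp[OF PrimRec.prems(2)] Z)
  then have step: "computable_fun A (\<lambda>z. if p2 (p2 z) = 0 then 0 else ?g (p1 z) (p1 (p2 z)) (p2 (p2 z)))"
    by (intro computability)
  have "computable_fun A (\<lambda>z. rec_nat (option_code (bounded_run f (s z) (Z z) (p1 (x z)))) (\<lambda>k r. if r = 0 then 0 else ?g z k r) (p2 (x z)))"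
    by (rule computable_fun_rec_nat) (fact f, fact step, intro computability PrimRec)
  moreover have "option_code (rec_nat (bounded_run f (s z) (Z z) p) (\<lambda>k r. Option.bind r (\<lambda>v. bounded_run g (s z) (Z z) (prod_encode (p, prod_encode (k, v))))) n)
     = rec_nat (option_code (bounded_run f (s z) (Z z) p)) (\<lambda>k r. if r = 0 then 0 else option_code (bounded_run g (s z) (Z z) (prod_encode (p, prod_encode (k, r - 1))))) n" for z p n
  proof (induction n)
    case (Suc n)
    show ?case
      by (simp only: nat.rec Suc[symmetric]) (auto simp: option_code_def split: option.splits)
  qed simp
  ultimately show ?case by simp
next
  case (Mu f)
  let ?f = "\<lambda>z n. option_code (bounded_run f (s z) (Z z) (prod_encode (x z, n)))"
  have Z: "computable_pred A (\<lambda>z. p2 z \<in> Z (p1 (p1 z)))"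
    using computable_pred_comp[OF Mu.prems(3), of "\<lambda>z. prod_encode (p1 (p1 z), p2 z)"]
    by (simp add: computability)
  have "computable_fun A (\<lambda>z. ?f (p1 z) (p2 z))"
    by (intro Mu.IH computability computable_fun_comp[OF Mu.prems(1)]
       computable_fun_comp[OF Mu.prems(2)] Z)
  note f = this computable_fun_comp[OF this, of "\<lambda>w. prod_encode (u w, v w)" for u v, simplified]
  have P: "computable_pred A (\<lambda>z. \<exists>n<s z. ?f z n = 1 \<and> (\<forall>m<n. ?f z m \<noteq> 0))"
    by (intro computability f Mu)
  \<comment> \<open>The alternative \<open>s z \<le> n\<close> makes the search total. The result is
    used only if there is a zero below \<open>s z\<close>, and then it is the true minimum.\<close>
  have L: "computable_fun A (\<lambda>z. LEAST n. s z \<le> n \<or> ?f z n = 1)"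
    by (intro computable_fun_Least computability f computable_fun_comp[OF Mu.prems(1)]) auto
  have "computable_fun A (\<lambda>z. if \<exists>n<s z. ?f z n = 1 \<and> (\<forall>m<n. ?f z m \<noteq> 0) then Suc (LEAST n. s z \<le> n \<or> ?f z n = 1) else 0)"
    by (intro computability P L)
  moreover have "(LEAST n. s z \<le> n \<or> ?f z n = 1) = (LEAST n. bounded_run f (s z) (Z z) (prod_encode (x z, n)) = Some 0)"
    if "n < s z" "?f z n = 1" for n z
  proof -
    have one: "?f z m = 1 \<longleftrightarrow> bounded_run f (s z) (Z z) (prod_encode (x z, m)) = Some 0" for m
      by (auto simp: option_code_def split: option.splits)
    let ?l = "LEAST n. ?f z n = 1"
    have l: "?f z ?l = 1" "?l \<le> n" using that by (auto intro: LeastI Least_le)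
    have "(LEAST n. s z \<le> n \<or> ?f z n = 1) = ?l"
      using that l by (intro Least_equality) (auto intro: Least_le)
    then show ?thesis by (simp only: one)
  qed
  moreover have "?f z m = 1 \<longleftrightarrow> bounded_run f (s z) (Z z) (prod_encode (x z, m)) = Some 0"
    "?f z m \<noteq> 0 \<longleftrightarrow> bounded_run f (s z) (Z z) (prod_encode (x z, m)) \<noteq> None" for z m
    by (auto simp: option_code_def split: option.splits)
  moreover have "option_code (bounded_run (Mu f) (s z) (Z z) (x z)) =
      (if \<exists>n<s z. ?f z n = 1 \<and> (\<forall>m<n. ?f z m \<noteq> 0) then Suc (LEAST n. s z \<le> n \<or> ?f z n = 1) else 0)" for z
    using calculation(2)[of _ z] calculation(3,4)[of z] by auto
  ultimately show ?case by simp
qed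

section \<open>The coin-tossing measure\<close>

lemma sets_coin_measure [measurable_cong]:
    "sets coin_measure = sets (PiM UNIV (\<lambda>_. count_space UNIV))"
  unfolding coin_measure_def by (intro sets_PiM_cong) auto

lemma space_coin_measure [simp]: "space coin_measure = UNIV"
  by (simp add: coin_measure_def space_PiM)

interpretation coin: prob_space coin_measure
  unfolding coin_measure_def by (intro prob_space_PiM measure_pmf.prob_space_axioms)

lemma sets_coin_coordinate [measurable]: "{f. f i = b} \<in> sets coin_measure"
proof -
  have "(\<lambda>f. f i) \<in> measurable coin_measure (count_space UNIV)"
    by measurable
  from measurable_sets[OF this, of "{b}"] show ?thesis
    by (simp add: vimage_def)
qed

lemma measure_coin_cylinder:
  assumes "finite J"
  shows "measure coin_measure {f. \<forall>i\<in>J. f i = h i} = (1/2) ^ card J"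
proof -
  let ?p = "measure_pmf (bernoulli_pmf (1/2))"
  interpret P: product_prob_space "\<lambda>_. ?p" UNIV
    by unfold_locales
  have "{f. \<forall>i\<in>J. f i = h i} = prod_emb UNIV (\<lambda>_. ?p) J (PiE J (\<lambda>i. {h i}))"
    by (simp add: prod_emb_def set_eq_iff restrict_PiE_iff Pi_iff)
  then have "measure coin_measure {f. \<forall>i\<in>J. f i = h i} = (\<Prod>i\<in>J. measure ?p {h i})"
    unfolding coin_measure_def using assms by (simp add: P.measure_PiM_emb)
  also have "\<dots> = (1/2) ^ card J"
    by (simp add: measure_pmf_single)
  finally show ?thesis .
qed

section \<open>Cylinders and events depending on finitely many bits\<close>

text \<open>A string of length \<open>s\<close> is given by the binary digits of \<open>m\<close>.
  The numbers below \<open>2 ^ s\<close> represent each such string once, so counting strings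
  becomes counting numbers.\<close>

definition cylinder :: "nat \<Rightarrow> nat \<Rightarrow> (nat \<Rightarrow> bool) set" where
  "cylinder s m = {f. \<forall>i<s. f i \<longleftrightarrow> i \<in> set_decode m}"

definition determined :: "nat \<Rightarrow> (nat \<Rightarrow> bool) set \<Rightarrow> bool" where
  "determined s U \<longleftrightarrow> (\<forall>f g. (\<forall>i<s. f i = g i) \<longrightarrow> f \<in> U \<longrightarrow> g \<in> U)"

lemma determinedD: "determined s U \<Longrightarrow> f \<in> U \<Longrightarrow> (\<And>i. i < s \<Longrightarrow> f i = g i) \<Longrightarrow> g \<in> U"
  unfolding determined_def by blast

lemma determined_mono: "determined s U \<Longrightarrow> s \<le> t \<Longrightarrow> determined t U"
unfolding determined_def[of t] by (intro allI impI) (erule (1) determinedD, simp)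

lemma determined_Compl: "determined s U \<Longrightarrow> determined s (- U)"
  unfolding determined_def by (metis (no_types, lifting) ComplD ComplI)

lemma determined_UN: "(\<And>i. i \<in> I \<Longrightarrow> determined s (U i)) \<Longrightarrow> determined s (\<Union>i\<in>I. U i)"
  unfolding determined_def by blast

lemma determined_Int: "determined s U \<Longrightarrow> determined s V \<Longrightarrow> determined s (U \<inter> V)"
  unfolding determined_def by blast

lemma determined_cylinder: "determined s (cylinder s m)"
  by (auto simp: determined_def cylinder_def)

lemma mem_cylinder_set_encode: "f \<in> cylinder s (set_encode {i. i < s \<and> f i})"
  by (simp add: cylinder_def)

lemma set_encode_lt_power:
  assumes "A \<subseteq> {..<s}"
  shows "set_encode A < 2 ^ s"
proof -
  have "set_encode A \<le> (\<Sum>i<s. 2 ^ i)"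
    unfolding set_encode_def using assms by (intro sum_mono2) auto
  also have "\<dots> < 2 ^ s"
    using sum_power2[of s] by (simp add: atLeast0LessThan)
  finally show ?thesis .
qed

lemma set_decode_subset: "m < 2 ^ s \<Longrightarrow> set_decode m \<subseteq> {..<s}"
proof
  fix i assume m: "m < 2 ^ s" and i: "i \<in> set_decode m"
  show "i \<in> {..<s}"
  proof (rule ccontr)
    assume "i \<notin> {..<s}"
    then have "(2::nat) ^ s \<le> 2 ^ i" by simp
    with m have "m < 2 ^ i" by (rule less_le_trans)
    then have "m div 2 ^ i = 0" by simp
    with i show False by (simp add: set_decode_def)
  qed
qed

lemma cylinder_eqD:
  assumes "f \<in> cylinder s m" "m < 2 ^ s"
  shows "m = set_encode {i. i < s \<and> f i}"
proof -
  have "{i. i < s \<and> f i} = set_decode m"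
    using assms(1) set_decode_subset[OF assms(2)] by (auto simp: cylinder_def)
  then show ?thesis by simp
qed

lemma sets_cylinder [measurable]: "cylinder s m \<in> sets coin_measure"
proof -
  have "cylinder s m = (\<Inter>i<s. {f. f i = (i \<in> set_decode m)})"
    by (auto simp: cylinder_def)
  also have "\<dots> \<in> sets coin_measure"
    by (cases "s = 0") (auto intro!: sets.finite_INT sets_coin_coordinate simp flip: space_coin_measure)
  finally show ?thesis .
qed

lemma measure_cylinder: "measure coin_measure (cylinder s m) = (1/2) ^ s"
  using measure_coin_cylinder[of "{..<s}" "\<lambda>i. i \<in> set_decode m"]
  by (simp add: cylinder_def lessThan_def)

lemma determined_eq_UN_cylinder:
  assumes "determined s U"
  shows "U = (\<Union>m\<in>{m. m < 2 ^ s \<and> (\<lambda>i. i \<in> set_decode m) \<in> U}. cylinder s m)"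
proof (intro set_eqI iffI)
  fix f assume f: "f \<in> U"
  let ?m = "set_encode {i. i < s \<and> f i}"
  have "?m < 2 ^ s" by (rule set_encode_lt_power) auto
  moreover have "(\<lambda>i. i \<in> set_decode ?m) \<in> U"
    by (rule determinedD[OF assms f]) simp
  ultimately show "f \<in> (\<Union>m\<in>{m. m < 2 ^ s \<and> (\<lambda>i. i \<in> set_decode m) \<in> U}. cylinder s m)"
    using mem_cylinder_set_encode by blast
next
  fix f assume "f \<in> (\<Union>m\<in>{m. m < 2 ^ s \<and> (\<lambda>i. i \<in> set_decode m) \<in> U}. cylinder s m)"
  then obtain m where m: "(\<lambda>i. i \<in> set_decode m) \<in> U" "f \<in> cylinder s m" by blast
  show "f \<in> U"
    using m(2) by (intro determinedD[OF assms m(1)]) (simp add: cylinder_def)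
qed

lemma sets_determined:
  assumes "determined s U"
  shows "U \<in> sets coin_measure"
  by (subst determined_eq_UN_cylinder[OF assms]) auto

lemma disjoint_cylinders: "disjoint_family_on (cylinder s) {..<2 ^ s}"
  unfolding disjoint_family_on_def using cylinder_eqD by blast

text \<open>This turns measures into counts, which a program can evaluate.\<close>

lemma measure_determined:
  assumes "determined s U"
  shows "measure coin_measure U = real (card {m. m < 2 ^ s \<and> (\<lambda>i. i \<in> set_decode m) \<in> U}) / 2 ^ s"
proof -
  let ?W = "{m. m < 2 ^ s \<and> (\<lambda>i. i \<in> set_decode m) \<in> U}"
  have "measure coin_measure (\<Union>m\<in>?W. cylinder s m) = (\<Sum>m\<in>?W. measure coin_measure (cylinder s m))"
    by (intro coin.finite_measure_finite_Union disjoint_family_on_mono[OF _ disjoint_cylinders]) auto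
  also have "\<dots> = real (card ?W) / 2 ^ s"
    by (simp add: measure_cylinder power_divide)
  finally show ?thesis
    by (simp only: determined_eq_UN_cylinder[OF assms, symmetric])
qed

text \<open>The approximable sets form a sigma-algebra containing the coordinate events. A countable
  union is first cut down to a finite one at a cost below \<open>\<epsilon> / 2\<close>; the errors
  of its finitely many members share the other half.\<close>

lemma approximate_by_determined:
  assumes "B \<in> sets coin_measure" "\<epsilon> > 0"
  shows "\<exists>s U. determined s U \<and> measure coin_measure (sym_diff B U) < \<epsilon>"
proof -
  let ?G = "{{f. f i = b} | i b. True}"
  have "sets coin_measure = sigma_sets UNIV {{f \<in> \<Pi>\<^sub>E i\<in>UNIV. space (count_space UNIV). f i \<in> A} |i A. i \<in> UNIV \<and> A \<in> sets (count_space (UNIV :: bool set))}"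
    by (simp only: sets_coin_measure sets_PiM_single) (simp add: PiE_UNIV_domain)
  then have "B \<in> sigma_sets UNIV {{f. f i \<in> A} |(i::nat) (A::bool set). True}"
    using assms(1) by (simp add: PiE_UNIV_domain)
  then show ?thesis using \<open>\<epsilon> > 0\<close>
  proof (induction arbitrary: \<epsilon>)
    case (Basic a)
    then obtain i A where "a = {f. f i \<in> A}" by blast
    then have "determined (Suc i) a" by (auto simp: determined_def)
    then show ?case using Basic by (intro exI[of _ "Suc i"] exI[of _ a]) simp
  next
    case Empty
    then show ?case by (intro exI[of _ 0] exI[of _ "{}"]) (simp add: determined_def)
  next
    case (Compl a)
    then obtain s U where "determined s U" "measure coin_measure (sym_diff a U) < \<epsilon>"
      by blast
    moreover have "sym_diff (UNIV - a) (- U) = sym_diff a U" by blast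
    ultimately show ?case
      using determined_Compl[of s U] by (intro exI[of _ s] exI[of _ "- U"]) simp
  next
    case (Union a)
    have a: "a n \<in> sets coin_measure" for n
      using Union.hyps by (simp add: sets_coin_measure sets_PiM_single PiE_UNIV_domain)
    have "(\<lambda>n. measure coin_measure (\<Union>i<n. a i)) \<longlonglongrightarrow> measure coin_measure (\<Union>n. \<Union>i<n. a i)"
      by (intro coin.finite_Lim_measure_incseq) (auto intro!: a sets.finite_UN incseq_SucI simp: less_Suc_eq)
    moreover have "(\<Union>n. \<Union>i<n. a i) = (\<Union>i. a i)" by auto
    ultimately have "(\<lambda>n. measure coin_measure (\<Union>i<n. a i)) \<longlonglongrightarrow> measure coin_measure (\<Union>i. a i)"
      by simp
    then have "eventually (\<lambda>n. measure coin_measure (\<Union>i<n. a i) > measure coin_measure (\<Union>i. a i) - \<epsilon> / 2) sequentially"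
      using Union.prems by (intro order_tendstoD) auto
    then obtain N where N: "measure coin_measure (\<Union>i<N. a i) > measure coin_measure (\<Union>i. a i) - \<epsilon> / 2"
      by (auto simp: eventually_sequentially)
    \<comment> \<open>The summand 1 keeps the tolerance meaningful for \<open>N = 0\<close>.\<close>
    have "\<exists>s U. determined s U \<and> measure coin_measure (sym_diff (a i) U) < \<epsilon> / (2 * (real N + 1))" for i
      using Union.prems by (intro Union.IH) auto
    then obtain s U where U: "\<And>i. determined (s i) (U i)"
        "\<And>i. measure coin_measure (sym_diff (a i) (U i)) < \<epsilon> / (2 * (real N + 1))"
      by metis
    let ?V = "\<Union>i<N. U i"
    have Usets: "U i \<in> sets coin_measure" for i using U(1) by (rule sets_determined)
    \<comment> \<open>The sum serves as a common length for the finitely many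
      \<open>U i\<close>.\<close>
    have "determined (\<Sum>i<N. s i) ?V"
      by (intro determined_UN determined_mono[OF U(1)] member_le_sum) auto
    moreover have "measure coin_measure (sym_diff (\<Union>i. a i) ?V) < \<epsilon>"
    proof -
      have "measure coin_measure (sym_diff (\<Union>i. a i) ?V)
          \<le> measure coin_measure (((\<Union>i. a i) - (\<Union>i<N. a i)) \<union> (\<Union>i<N. sym_diff (a i) (U i)))"
        using a Usets by (intro coin.finite_measure_mono) auto
      also have "\<dots> \<le> measure coin_measure ((\<Union>i. a i) - (\<Union>i<N. a i)) + measure coin_measure (\<Union>i<N. sym_diff (a i) (U i))"
        using a Usets by (intro measure_Un_le) auto
      also have "measure coin_measure ((\<Union>i. a i) - (\<Union>i<N. a i)) = measure coin_measure (\<Union>i. a i) - measure coin_measure (\<Union>i<N. a i)"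
        using a by (intro coin.finite_measure_Diff) auto
      also have "measure coin_measure (\<Union>i<N. sym_diff (a i) (U i)) \<le> (\<Sum>i<N. measure coin_measure (sym_diff (a i) (U i)))"
        using a Usets by (intro coin.finite_measure_subadditive_finite) auto
      also have "\<dots> \<le> (\<Sum>i<N. \<epsilon> / (2 * (real N + 1)))"
        using U(2) by (intro sum_mono less_imp_le)
      also have "\<dots> \<le> \<epsilon> / 2"
        using Union.prems by (simp add: field_simps)
      finally show ?thesis using N by simp
    qed
    ultimately show ?case by blast
  qed
qed

text \<open>A weak form of the Lebesgue density theorem.\<close>

lemma ex_cylinder_dense:
  assumes B: "B \<in> sets coin_measure" and pos: "measure coin_measure B > 0"
  shows "\<exists>s m. measure coin_measure (B \<inter> cylinder s m) > 3/4 * measure coin_measure (cylinder s m)"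
proof (rule ccontr)
  assume "\<not> ?thesis"
  then have le: "measure coin_measure (B \<inter> cylinder s m) \<le> 3/4 * measure coin_measure (cylinder s m)" for s m
    by (simp add: not_less)
  \<comment> \<open>With \<open>b\<close> for the measure of \<open>B\<close>, the bound
    \<open>b / 8\<close> leads to \<open>b \<le> 3/4 * (9/8 * b) + b / 8 = 31/32 * b\<close>, a
    contradiction.\<close>
  obtain s U where U: "determined s U" "measure coin_measure (sym_diff B U) < measure coin_measure B / 8"
    using approximate_by_determined[OF B, of "measure coin_measure B / 8"] pos by auto
  have [measurable]: "U \<in> sets coin_measure" using U(1) by (rule sets_determined)
  note [measurable] = B
  let ?W = "{m. m < 2 ^ s \<and> (\<lambda>i. i \<in> set_decode m) \<in> U}"
  have fin: "finite ?W" by simp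
  have eq: "U = (\<Union>m\<in>?W. cylinder s m)" by (rule determined_eq_UN_cylinder[OF U(1)])
  have dis: "disjoint_family_on (cylinder s) ?W"
    by (rule disjoint_family_on_mono[OF _ disjoint_cylinders]) auto
  have "measure coin_measure (B \<inter> U) = measure coin_measure (\<Union>m\<in>?W. B \<inter> cylinder s m)"
    by (subst eq) (simp only: Int_UN_distrib)
  also have "\<dots> = (\<Sum>m\<in>?W. measure coin_measure (B \<inter> cylinder s m))"
    using dis by (intro coin.finite_measure_finite_Union fin) (auto simp: disjoint_family_on_def)
  also have "\<dots> \<le> (\<Sum>m\<in>?W. 3/4 * measure coin_measure (cylinder s m))"
    by (intro sum_mono le)
  also have "\<dots> = 3/4 * (\<Sum>m\<in>?W. measure coin_measure (cylinder s m))"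
    by (simp only: sum_distrib_left)
  also have "(\<Sum>m\<in>?W. measure coin_measure (cylinder s m)) = measure coin_measure U"
    using dis by (subst (2) eq, intro coin.finite_measure_finite_Union[symmetric] fin) auto
  finally have 1: "measure coin_measure (B \<inter> U) \<le> 3/4 * measure coin_measure U" .
  have "measure coin_measure U \<le> measure coin_measure (B \<union> sym_diff B U)"
    by (intro coin.finite_measure_mono) auto
  also have "\<dots> \<le> measure coin_measure B + measure coin_measure (sym_diff B U)"
    by (intro measure_Un_le) auto
  finally have 2: "measure coin_measure U \<le> measure coin_measure B + measure coin_measure (sym_diff B U)" .
  have "measure coin_measure B \<le> measure coin_measure ((B \<inter> U) \<union> sym_diff B U)"
    by (intro coin.finite_measure_mono) auto
  also have "\<dots> \<le> measure coin_measure (B \<inter> U) + measure coin_measure (sym_diff B U)"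
    by (intro measure_Un_le) auto
  finally show False using 1 2 U(2) pos by linarith
qed

section \<open>Measurability of classes defined by functionals\<close>

lemma determined_bounded_run: "determined s {f. Q (bounded_run \<Phi> s (Collect f) x)}"
  unfolding determined_def
proof (intro allI impI)
  fix f g :: "nat \<Rightarrow> bool"
  assume "\<forall>i<s. f i = g i" and f: "f \<in> {f. Q (bounded_run \<Phi> s (Collect f) x)}"
  then have "bounded_run \<Phi> s (Collect f) = bounded_run \<Phi> s (Collect g)"
    by (intro bounded_run_cong) auto
  with f show "g \<in> {f. Q (bounded_run \<Phi> s (Collect f) x)}" by simp
qed

lemma sets_run:
  "{f. run \<Phi> (Collect f) x = Some v} \<in> sets coin_measure"
proof -
  have "run \<Phi> Z x = Some v \<longleftrightarrow> (\<exists>s. bounded_run \<Phi> s Z x = Some v)" for Z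
    using bounded_run_sound[of \<Phi> _ Z x v] bounded_run_complete[of \<Phi> Z x v] by auto
  then have "{f. run \<Phi> (Collect f) x = Some v} = (\<Union>s. {f. bounded_run \<Phi> s (Collect f) x = Some v})"
    by auto
  also have "\<dots> \<in> sets coin_measure"
    by (intro sets.countable_UN image_subsetI sets_determined[OF determined_bounded_run[of _ "\<lambda>r. r = Some v"]]) 
  finally show ?thesis .
qed

lemma sets_Pi03_class:
  assumes "Pi03_class Y C"
  shows "{f. Collect f \<in> C} \<in> sets coin_measure"
proof -
  obtain R where C: "C = {X. \<forall>a. \<exists>b. \<forall>c. prod_encode (a, prod_encode (b, initial_segment X c)) \<in> R}"
    using assms unfolding Pi03_class_def by blast
  have det: "determined c {f. prod_encode (a, prod_encode (b, initial_segment (Collect f) c)) \<in> R}" for a b c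
  proof -
    have "initial_segment (Collect f) c = initial_segment (Collect g) c" if "\<forall>i<c. f i = g i" for f g
      unfolding initial_segment_def using that by (auto intro!: arg_cong[of _ _ list_encode])
    then show ?thesis unfolding determined_def by (metis (mono_tags, lifting) mem_Collect_eq)
  qed
  have "{f. Collect f \<in> C} = (\<Inter>a. \<Union>b. \<Inter>c. {f. prod_encode (a, prod_encode (b, initial_segment (Collect f) c)) \<in> R})"
    by (auto simp: C)
  also have "\<dots> \<in> sets coin_measure"
    by (intro sets.countable_INT sets.countable_UN image_subsetI sets_determined[OF det]) auto
  finally show ?thesis .
qed

section \<open>Majority vote\<close>

definition describing :: "functional \<Rightarrow> nat set \<Rightarrow> nat set set" where
  "describing \<Phi> A = {Z. \<exists>D. computes_set \<Phi> Z D \<and> coarse_description D A}"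

section \<open>Sets of density zero\<close>

lemma has_density_0_dominated:
  assumes "\<And>n. partial_density n S \<le> g n" "g \<longlonglongrightarrow> 0"
  shows "has_density S 0"
proof -
  have "norm (partial_density n S) \<le> g n" for n
    using assms(1)[of n] by (simp add: partial_density_def)
  then show ?thesis
    unfolding has_density_def by (intro Lim_null_comparison[OF always_eventually assms(2)]) simp
qed

text \<open>With error bounds of the form \<open>1 / a\<close> and cleared denominators, the limit
  becomes an arithmetical condition on natural numbers, as the \<Pi>03 definition requires.\<close>

lemma has_density_0_iff:
  "has_density S 0 \<longleftrightarrow> (\<forall>a::nat. \<exists>b. \<forall>n\<ge>b. a * card (S \<inter> {0..<n}) \<le> n)"
proof
  assume S: "has_density S 0"
  show "\<forall>a::nat. \<exists>b. \<forall>n\<ge>b. a * card (S \<inter> {0..<n}) \<le> n"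
  proof
    fix a :: nat
    have "eventually (\<lambda>n. partial_density n S < 1 / (real a + 1)) sequentially"
      using S unfolding has_density_def by (intro order_tendstoD) auto
    then obtain b where b: "\<And>n. n \<ge> b \<Longrightarrow> partial_density n S < 1 / (real a + 1)"
      by (auto simp: eventually_sequentially)
    have "a * card (S \<inter> {0..<n}) \<le> n" if "n \<ge> b" for n
    proof (cases "n = 0")
      case False
      then have "real (card (S \<inter> {0..<n})) * (real a + 1) < real n"
        using b[OF that] by (simp add: partial_density_def field_simps)
      then have "real (a * card (S \<inter> {0..<n})) \<le> real n"
        by (simp add: algebra_simps)
      then show ?thesis by linarith
    qed simp
    then show "\<exists>b. \<forall>n\<ge>b. a * card (S \<inter> {0..<n}) \<le> n" by blast
  qed
next
  assume S: "\<forall>a::nat. \<exists>b. \<forall>n\<ge>b. a * card (S \<inter> {0..<n}) \<le> n"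
  show "has_density S 0"
    unfolding has_density_def
  proof (rule LIMSEQ_I)
    fix r :: real assume "r > 0"
    then obtain a where a: "a > 0" "inverse (real a) < r"
      using ex_inverse_of_nat_less by blast
    obtain b where b: "\<And>n. n \<ge> b \<Longrightarrow> a * card (S \<inter> {0..<n}) \<le> n"
      using S by blast
    have "norm (partial_density n S - 0) < r" if "n \<ge> Suc b" for n
    proof -
      have "real (a * card (S \<inter> {0..<n})) \<le> real n"
        using b[of n] that by (simp only: of_nat_le_iff)
      then have "partial_density n S \<le> inverse (real a)"
        using a that by (simp add: partial_density_def field_simps)
      then show ?thesis using a by (simp add: partial_density_def)
    qed
    then show "\<exists>no. \<forall>n\<ge>no. norm (partial_density n S - 0) < r" by blast
  qed
qed

lemma has_density_0_subset:
  assumes "has_density T 0" "S \<subseteq> T"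
  shows "has_density S 0"
  unfolding has_density_0_iff
proof
  fix a :: nat
  obtain b where b: "\<And>n. n \<ge> b \<Longrightarrow> a * card (T \<inter> {0..<n}) \<le> n"
    using assms(1) unfolding has_density_0_iff by blast
  have "a * card (S \<inter> {0..<n}) \<le> a * card (T \<inter> {0..<n})" for n
    using assms(2) by (intro mult_le_mono card_mono) auto
  with b show "\<exists>b. \<forall>n\<ge>b. a * card (S \<inter> {0..<n}) \<le> n"
    by (meson le_trans)
qed

lemma coarse_description_sym: "coarse_description D E \<Longrightarrow> coarse_description E D"
  by (simp add: coarse_description_def Un_commute)

lemma coarse_description_trans:
  assumes "coarse_description D E" "coarse_description E F"
  shows "coarse_description D F"
proof -
  let ?S = "sym_diff D E" and ?T = "sym_diff E F"
  have "partial_density n (?S \<union> ?T) \<le> partial_density n ?S + partial_density n ?T" for n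
  proof -
    have "card ((?S \<union> ?T) \<inter> {0..<n}) \<le> card (?S \<inter> {0..<n}) + card (?T \<inter> {0..<n})"
      using card_Un_le[of "?S \<inter> {0..<n}" "?T \<inter> {0..<n}"] by (simp add: Int_Un_distrib2)
    then show ?thesis
      unfolding partial_density_def by (simp flip: add_divide_distrib of_nat_add add: divide_right_mono)
  qed
  moreover have "(\<lambda>n. partial_density n ?S + partial_density n ?T) \<longlonglongrightarrow> 0"
    using tendsto_add assms unfolding coarse_description_def has_density_def by fastforce
  ultimately have "has_density (?S \<union> ?T) 0"
    by (rule has_density_0_dominated)
  then show ?thesis
    unfolding coarse_description_def by (rule has_density_0_subset) auto
qed

section \<open>Complexity of the class of successful oracles\<close>

text \<open>A total functional with values 0 and 1 determines the set it computes, so the quantifier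
  over \<open>D\<close> disappears.\<close>

lemma describing_iff:
  "Z \<in> describing \<Phi> A \<longleftrightarrow>
     (\<forall>k. run \<Phi> Z k = Some 0 \<or> run \<Phi> Z k = Some 1) \<and>
     has_density {k. run \<Phi> Z k \<noteq> Some (of_bool (k \<in> A))} 0"
proof
  assume "Z \<in> describing \<Phi> A"
  then obtain D where D: "\<And>k. run \<Phi> Z k = Some (of_bool (k \<in> D))" "coarse_description D A"
    unfolding describing_def computes_set_def by blast
  have "sym_diff D A = {k. run \<Phi> Z k \<noteq> Some (of_bool (k \<in> A))}"
    by (auto simp: D(1))
  with D show "(\<forall>k. run \<Phi> Z k = Some 0 \<or> run \<Phi> Z k = Some 1) \<and>
     has_density {k. run \<Phi> Z k \<noteq> Some (of_bool (k \<in> A))} 0"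
    by (simp add: coarse_description_def)
next
  assume *: "(\<forall>k. run \<Phi> Z k = Some 0 \<or> run \<Phi> Z k = Some 1) \<and>
     has_density {k. run \<Phi> Z k \<noteq> Some (of_bool (k \<in> A))} 0"
  define D where "D = {k. run \<Phi> Z k = Some 1}"
  have D: "run \<Phi> Z k = Some (of_bool (k \<in> D))" for k
    using *[THEN conjunct1, rule_format, of k] by (auto simp: D_def)
  have "sym_diff D A = {k. run \<Phi> Z k \<noteq> Some (of_bool (k \<in> A))}"
    by (auto simp: D)
  with * D have "computes_set \<Phi> Z D" "coarse_description D A"
    by (simp_all add: computes_set_def coarse_description_def)
  then show "Z \<in> describing \<Phi> A" unfolding describing_def by blast
qed

text \<open>
  To save a quantifier, \<open>a\<close> is both the argument at which convergence is demanded and the bound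
  \<open>1 / a\<close> on the error, and \<open>b\<close> both the stage of convergence and the threshold for this bound.
  Errors not yet visible at stage \<open>c\<close> appear at a later stage.
\<close>

lemma describing_iff_bounded_run:
  "Z \<in> describing \<Phi> A \<longleftrightarrow>
     (\<forall>a. \<exists>b. \<forall>c. (b \<le> c \<longrightarrow> bounded_run \<Phi> b Z a = Some 0 \<or> bounded_run \<Phi> b Z a = Some 1) \<and>
        (\<forall>n<c. b \<le> n \<longrightarrow> a * card {k. k < n \<and> bounded_run \<Phi> c Z k \<noteq> None \<and>
            bounded_run \<Phi> c Z k \<noteq> Some (of_bool (k \<in> A))} \<le> n))" (is "_ \<longleftrightarrow> (\<forall>a. \<exists>b. \<forall>c. ?conv a b c \<and> ?err a b c)")
proof
  assume Z: "Z \<in> describing \<Phi> A"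
  show "\<forall>a. \<exists>b. \<forall>c. ?conv a b c \<and> ?err a b c"
  proof
    fix a
    let ?E = "{k. run \<Phi> Z k \<noteq> Some (of_bool (k \<in> A))}"
    obtain s where s: "bounded_run \<Phi> s Z a = Some 0 \<or> bounded_run \<Phi> s Z a = Some 1"
      using Z bounded_run_complete unfolding describing_iff by metis
    obtain d where d: "\<And>n. n \<ge> d \<Longrightarrow> a * card (?E \<inter> {0..<n}) \<le> n"
      using Z unfolding describing_iff has_density_0_iff by blast
    \<comment> \<open>Convergence persists to later stages and the error bound to larger thresholds,
      so one number can serve as both.\<close>
    have "?conv a (max s d) c \<and> ?err a (max s d) c" for c
    proof (intro conjI impI allI)
      show "bounded_run \<Phi> (max s d) Z a = Some 0 \<or> bounded_run \<Phi> (max s d) Z a = Some 1"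
        using s bounded_run_mono[of \<Phi> s Z a _ "max s d"] by auto
      fix n assume "n < c" "max s d \<le> n"
      have "card {k. k < n \<and> bounded_run \<Phi> c Z k \<noteq> None \<and> bounded_run \<Phi> c Z k \<noteq> Some (of_bool (k \<in> A))}
          \<le> card (?E \<inter> {0..<n})"
        by (intro card_mono) (use bounded_run_sound in fastforce)+
      then have "a * card {k. k < n \<and> bounded_run \<Phi> c Z k \<noteq> None \<and> bounded_run \<Phi> c Z k \<noteq> Some (of_bool (k \<in> A))}
          \<le> a * card (?E \<inter> {0..<n})"
        by (rule mult_le_mono2)
      also have "\<dots> \<le> n" using d \<open>max s d \<le> n\<close> by simp
      finally show "a * card {k. k < n \<and> bounded_run \<Phi> c Z k \<noteq> None \<and> bounded_run \<Phi> c Z k \<noteq> Some (of_bool (k \<in> A))} \<le> n" .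
    qed
    then show "\<exists>b. \<forall>c. ?conv a b c \<and> ?err a b c" by blast
  qed
next
  assume *: "\<forall>a. \<exists>b. \<forall>c. ?conv a b c \<and> ?err a b c"
  \<comment> \<open>The choice \<open>c = b\<close> fulfils the guard
    \<open>b \<le> c\<close>.\<close>
  have conv: "\<exists>s. bounded_run \<Phi> s Z k = Some 0 \<or> bounded_run \<Phi> s Z k = Some 1" for k
    using * by (meson order_refl)
  then have total: "run \<Phi> Z k = Some 0 \<or> run \<Phi> Z k = Some 1" for k
    using bounded_run_sound by metis
  from conv obtain S where S: "\<And>k. bounded_run \<Phi> (S k) Z k \<noteq> None"
    by (metis option.distinct(1))
  have "has_density {k. run \<Phi> Z k \<noteq> Some (of_bool (k \<in> A))} 0"
    unfolding has_density_0_iff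
  proof
    fix a
    obtain b where b: "\<And>c. ?err a b c" using * by meson
    have "a * card ({k. run \<Phi> Z k \<noteq> Some (of_bool (k \<in> A))} \<inter> {0..<n}) \<le> n" if "n \<ge> b" for n
    proof -
      \<comment> \<open>\<open>Suc n\<close> gives \<open>n < c\<close>, and the sum makes every
        computation below \<open>n\<close> converge by stage \<open>c\<close>, so all errors below
        \<open>n\<close> are visible.\<close>
      define c where "c = Suc n + (\<Sum>k<n. S k)"
      have bounded_run_run: "bounded_run \<Phi> c Z k = run \<Phi> Z k" if "k < n" for k
      proof -
        have "S k \<le> (\<Sum>k<n. S k)" using that by (intro member_le_sum) auto
        then have "S k \<le> c" by (simp add: c_def)
        moreover obtain v where v: "bounded_run \<Phi> (S k) Z k = Some v" using S[of k] by blast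
        ultimately have "bounded_run \<Phi> c Z k = Some v" by (auto elim: bounded_run_mono)
        with bounded_run_sound[OF v] show ?thesis by simp
      qed
      have "{k. run \<Phi> Z k \<noteq> Some (of_bool (k \<in> A))} \<inter> {0..<n} =
          {k. k < n \<and> bounded_run \<Phi> c Z k \<noteq> None \<and> bounded_run \<Phi> c Z k \<noteq> Some (of_bool (k \<in> A))}"
      proof (intro set_eqI)
        fix k
        show "k \<in> {k. run \<Phi> Z k \<noteq> Some (of_bool (k \<in> A))} \<inter> {0..<n} \<longleftrightarrow>
            k \<in> {k. k < n \<and> bounded_run \<Phi> c Z k \<noteq> None \<and> bounded_run \<Phi> c Z k \<noteq> Some (of_bool (k \<in> A))}"
          using bounded_run_run[of k] total[of k] by (cases "k < n") auto
      qed
      then show ?thesis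
        using b[of c] that by (simp add: c_def)
    qed
    then show "\<exists>b. \<forall>n\<ge>b. a * card ({k. run \<Phi> Z k \<noteq> Some (of_bool (k \<in> A))} \<inter> {0..<n}) \<le> n"
      by blast
  qed
  with total show "Z \<in> describing \<Phi> A" unfolding describing_iff by blast
qed

text \<open>Evaluating the matrix at \<open>c\<close> takes only the first \<open>c\<close> bits of
  \<open>Z\<close>, recovered from the code of the initial segment; the comparison with
  \<open>A\<close> is made through \<open>Y\<close>.\<close>

lemma Pi03_class_describing:
  assumes "A \<le>\<^sub>T Y"
  shows "Pi03_class Y (describing \<Phi> A)"
proof -
  define P where "P a b c Z \<longleftrightarrow>
      (b \<le> c \<longrightarrow> bounded_run \<Phi> b Z a = Some 0 \<or> bounded_run \<Phi> b Z a = Some 1) \<and>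
      (\<forall>n<c. b \<le> n \<longrightarrow> a * card {k. k < n \<and> bounded_run \<Phi> c Z k \<noteq> None \<and>
            bounded_run \<Phi> c Z k \<noteq> Some (of_bool (k \<in> A))} \<le> n)" for a b c Z
  define R where "R = {z. P (p1 z) (p1 (p2 z)) (code_length (p2 (p2 z))) (code_set (p2 (p2 z)))}"
  \<comment> \<open>Here the guard \<open>b \<le> c\<close> matters: it ensures that a run at stage
    \<open>b\<close> reads no bit beyond the first \<open>c\<close>.\<close>
  have P_cong: "P a b c Z \<longleftrightarrow> P a b c Z'" if "\<And>i. i < c \<Longrightarrow> i \<in> Z \<longleftrightarrow> i \<in> Z'" for a b c Z Z'
  proof -
    have "bounded_run \<Phi> c Z = bounded_run \<Phi> c Z'" using that by (rule bounded_run_cong)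
    moreover have "bounded_run \<Phi> b Z = bounded_run \<Phi> b Z'" if "b \<le> c"
      using \<open>b \<le> c\<close> \<open>\<And>i. i < c \<Longrightarrow> i \<in> Z \<longleftrightarrow> i \<in> Z'\<close> by (intro bounded_run_cong) auto
    ultimately show ?thesis by (auto simp: P_def)
  qed
  have "prod_encode (a, prod_encode (b, initial_segment Z c)) \<in> R \<longleftrightarrow> P a b c Z" for a b c Z
    unfolding R_def by (simp add: code_length_initial_segment) (rule P_cong, rule code_set_initial_segment)
  then have "describing \<Phi> A =
      {Z. \<forall>a. \<exists>b. \<forall>c. prod_encode (a, prod_encode (b, initial_segment Z c)) \<in> R}"
    unfolding set_eq_iff describing_iff_bounded_run P_def[symmetric] by simp
  moreover have "R \<le>\<^sub>T Y"
  proof -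
    have some: "bounded_run \<Phi> s Z k = Some v \<longleftrightarrow> option_code (bounded_run \<Phi> s Z k) = Suc v"
      and none: "bounded_run \<Phi> s Z k = None \<longleftrightarrow> option_code (bounded_run \<Phi> s Z k) = 0" for s Z k v
      by (simp_all add: option_code_def split: option.splits)
    have A: "computable_pred Y (\<lambda>x. f x \<in> A)" if "computable_fun Y f" for f
      using assms that unfolding turing_le_iff_computable_pred by (rule computable_pred_comp)
    have "computable_pred Y (\<lambda>z. z \<in> R)"
      unfolding R_def mem_Collect_eq P_def some none
      by (intro computability computable_fun_bounded_run A)
    then show ?thesis unfolding turing_le_iff_computable_pred .
  qed
  ultimately show ?thesis unfolding Pi03_class_def by blast
qed

section \<open>Error probabilities\<close>

text \<open>Membership in the class is built in so that the proportion of errors below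
  \<open>n\<close> tends to 0 for every \<open>f\<close>: inside the class by the choice of the
  class, outside it because no error is counted.\<close>

definition error_event :: "functional \<Rightarrow> nat set \<Rightarrow> nat \<Rightarrow> (nat \<Rightarrow> bool) set" where
  "error_event \<Phi> A k =
     {f. Collect f \<in> describing \<Phi> A \<and> run \<Phi> (Collect f) k \<noteq> Some (of_bool (k \<in> A))}"

text \<open>Relative to \<open>A\<close> itself the class is always \<Pi>03, so it is measurable for
  arbitrary \<open>A\<close>.\<close>

lemma sets_describing: "{f. Collect f \<in> describing \<Phi> A} \<in> sets coin_measure"
  by (rule sets_Pi03_class[OF Pi03_class_describing[OF turing_le_refl]])

lemma sets_error_event [measurable]: "error_event \<Phi> A k \<in> sets coin_measure"
proof -
  have "error_event \<Phi> A k = {f. Collect f \<in> describing \<Phi> A} - {f. run \<Phi> (Collect f) k = Some (of_bool (k \<in> A))}"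
    by (auto simp: error_event_def)
  then show ?thesis using sets_describing sets_run by auto
qed

text \<open>The average is the expectation of the proportion of errors below \<open>n\<close>, which
  is bounded by 1 and converges to 0 pointwise.\<close>

lemma average_error_tendsto_0:
  "(\<lambda>n. (\<Sum>k<n. measure coin_measure (error_event \<Phi> A k)) / real n) \<longlonglongrightarrow> 0"
proof -
  let ?u = "\<lambda>n f. (\<Sum>k<n. indicat_real (error_event \<Phi> A k) f) / real n"
  have "(\<lambda>n. integral\<^sup>L coin_measure (?u n)) \<longlonglongrightarrow> integral\<^sup>L coin_measure (\<lambda>f. 0)"
  proof (rule integral_dominated_convergence[where w = "\<lambda>_. 1"])
    show "?u n \<in> borel_measurable coin_measure" for n by measurable
    show "AE f in coin_measure. norm (?u n f) \<le> 1" for n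
    proof (rule AE_I2)
      fix f
      have "(\<Sum>k<n. indicat_real (error_event \<Phi> A k) f) \<le> (\<Sum>k<n. 1)"
        by (intro sum_mono) (simp add: indicator_def)
      then show "norm (?u n f) \<le> 1"
        by (cases "n = 0") (simp_all add: sum_nonneg field_simps)
    qed
    show "AE f in coin_measure. (\<lambda>n. ?u n f) \<longlonglongrightarrow> 0"
    proof (rule AE_I2)
      fix f
      show "(\<lambda>n. ?u n f) \<longlonglongrightarrow> 0"
      proof (cases "Collect f \<in> describing \<Phi> A")
        case True
        then have "has_density {k. run \<Phi> (Collect f) k \<noteq> Some (of_bool (k \<in> A))} 0"
          unfolding describing_iff by blast
        moreover have "(\<Sum>k<n. indicat_real (error_event \<Phi> A k) f)
            = card ({k. run \<Phi> (Collect f) k \<noteq> Some (of_bool (k \<in> A))} \<inter> {0..<n})" for n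
          using True by (simp add: error_event_def indicator_def sum.If_cases Int_commute atLeast0LessThan)
        ultimately show ?thesis
          unfolding has_density_def partial_density_def by simp
      next
        case False
        then show ?thesis by (simp add: error_event_def)
      qed
    qed
  qed auto
  moreover have "integral\<^sup>L coin_measure (?u n) = (\<Sum>k<n. measure coin_measure (error_event \<Phi> A k)) / real n" for n
  proof -
    have "(\<integral>f. (\<Sum>k<n. indicat_real (error_event \<Phi> A k) f) \<partial>coin_measure) =
        (\<Sum>k<n. measure coin_measure (error_event \<Phi> A k))"
      by (subst Bochner_Integration.integral_sum) (auto simp: coin.emeasure_eq_measure)
    then show ?thesis by simp
  qed
  ultimately show ?thesis by (simp only: Bochner_Integration.integral_zero)
qed

text \<open>This is Markov's inequality for the counting measure below \<open>n\<close>, applied to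
  the averages.\<close>

lemma has_density_0_large_error:
  assumes "\<delta> > 0"
  shows "has_density {k. measure coin_measure (error_event \<Phi> A k) \<ge> \<delta>} 0"
proof -
  let ?W = "{k. measure coin_measure (error_event \<Phi> A k) \<ge> \<delta>}"
  have "partial_density n ?W \<le> (\<Sum>k<n. measure coin_measure (error_event \<Phi> A k)) / real n / \<delta>" for n
  proof -
    have "\<delta> * card (?W \<inter> {0..<n}) = (\<Sum>k\<in>?W \<inter> {0..<n}. \<delta>)"
      by simp
    also have "\<dots> \<le> (\<Sum>k\<in>?W \<inter> {0..<n}. measure coin_measure (error_event \<Phi> A k))"
      by (intro sum_mono) auto
    also have "\<dots> \<le> (\<Sum>k<n. measure coin_measure (error_event \<Phi> A k))"
      by (intro sum_mono2) auto
    finally have "card (?W \<inter> {0..<n}) \<le> (\<Sum>k<n. measure coin_measure (error_event \<Phi> A k)) / \<delta>"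
      using assms by (simp add: field_simps)
    from divide_right_mono[OF this, of "real n"] show ?thesis
      by (simp add: partial_density_def mult.commute)
  qed
  moreover have "(\<lambda>n. (\<Sum>k<n. measure coin_measure (error_event \<Phi> A k)) / real n / \<delta>) \<longlonglongrightarrow> 0"
    using tendsto_divide[OF average_error_tendsto_0 tendsto_const[of \<delta>]] assms by simp
  ultimately show ?thesis by (rule has_density_0_dominated)
qed

text \<open>This serves to force an overlap: two parts of \<open>C\<close> whose measures add up to
  more than that of \<open>C\<close> must meet.\<close>

lemma measure_Int_ge:
  assumes "V \<in> sets coin_measure" "W \<in> sets coin_measure" "C \<in> sets coin_measure"
    and "V \<subseteq> C" "W \<subseteq> C"
  shows "measure coin_measure (V \<inter> W) \<ge> measure coin_measure V + measure coin_measure W - measure coin_measure C"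
proof -
  have "measure coin_measure V = measure coin_measure ((V \<inter> W) \<union> (V - W))"
    by (rule arg_cong[of _ _ "measure coin_measure"]) auto
  also have "\<dots> = measure coin_measure (V \<inter> W) + measure coin_measure (V - W)"
    using assms by (intro coin.finite_measure_Union) auto
  also have "measure coin_measure (V - W) \<le> measure coin_measure (C - W)"
    using assms by (intro coin.finite_measure_mono) auto
  also have "measure coin_measure (C - W) = measure coin_measure C - measure coin_measure W"
    using assms by (intro coin.finite_measure_Diff) auto
  finally show ?thesis by simp
qed

section \<open>The vote on a dense cylinder\<close>

lemma coarsely_computable_if_describing_positive:
  assumes "measure coin_measure {f. Collect f \<in> describing \<Phi> A} > 0"
  shows "coarsely_computable A"
proof -
  let ?\<mu> = "measure coin_measure"
  define B where "B = {f. Collect f \<in> describing \<Phi> A}"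
  have B [measurable]: "B \<in> sets coin_measure" unfolding B_def by (rule sets_describing)
  obtain l v where lv: "?\<mu> (B \<inter> cylinder l v) > 3/4 * ?\<mu> (cylinder l v)"
    using ex_cylinder_dense[OF B] assms unfolding B_def by blast
  define C where "C = cylinder l v"
  have C [measurable]: "C \<in> sets coin_measure" unfolding C_def by measurable
  define V where "V b k s = C \<inter> {f. bounded_run \<Phi> s (Collect f) k = Some b}" for b k s
  \<comment> \<open>This counts the strings of length \<open>s\<close> in the cylinder that vote
    \<open>b\<close> at \<open>k\<close>; divided by \<open>2 ^ s\<close> it is the measure of
    \<open>V b k s\<close> once \<open>l \<le> s\<close>.\<close>
  define cnt where "cnt b k s = card {m. m < 2 ^ s \<and> (\<forall>i<l. i \<in> set_decode m \<longleftrightarrow> i \<in> set_decode v) \<and>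
      bounded_run \<Phi> s (set_decode m) k = Some b}" for b k s
  \<comment> \<open>Votes have been cast on more than 3/4 of \<open>C\<close>, written without
    denominators so that it can be decided in natural numbers.\<close>
  define cond where "cond k s \<longleftrightarrow> l \<le> s \<and> 3 * 2 ^ s < 4 * 2 ^ l * (cnt 0 k s + cnt 1 k s)" for k s
  have V_sets [measurable]: "V b k s \<in> sets coin_measure" for b k s
    unfolding V_def using sets_determined[OF determined_bounded_run[of s "\<lambda>r. r = Some b" \<Phi> k]] by auto
  have V_measure: "?\<mu> (V b k s) = cnt b k s / 2 ^ s" if "l \<le> s" for b k s
  proof -
    have "determined s (V b k s)"
      unfolding V_def C_def using that
      by (intro determined_Int determined_mono[OF determined_cylinder] determined_bounded_run[of s "\<lambda>r. r = Some b"])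
    then show ?thesis
      by (subst measure_determined) (simp_all add: V_def C_def cylinder_def cnt_def)
  qed
  have \<mu>C: "?\<mu> C = 1 / 2 ^ l"
    unfolding C_def by (simp add: measure_cylinder power_divide)
  have cond_iff: "cond k s \<longleftrightarrow> l \<le> s \<and> ?\<mu> (V 0 k s) + ?\<mu> (V 1 k s) > 3/4 * ?\<mu> C" for k s
  proof (cases "l \<le> s")
    case True
    have "3 * 2 ^ s < 4 * 2 ^ l * (cnt 0 k s + cnt 1 k s) \<longleftrightarrow>
       real (3 * 2 ^ s) < real (4 * 2 ^ l * (cnt 0 k s + cnt 1 k s))"
      by (simp only: of_nat_less_iff)
    also have "\<dots> \<longleftrightarrow> ?\<mu> (V 0 k s) + ?\<mu> (V 1 k s) > 3/4 * ?\<mu> C"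
      using True by (simp add: V_measure \<mu>C field_simps)
    finally show ?thesis using True by (simp add: cond_def)
  qed (simp add: cond_def)
  \<comment> \<open>The voters increase with the stage to a set that includes
    \<open>B \<inter> C\<close>, since members of the class vote eventually. By continuity of the
    measure some finite stage exceeds 3/4 of \<open>C\<close>.\<close>
  have ex_cond: "\<exists>s. cond k s" for k
  proof -
    have V_mono: "V b k s \<subseteq> V b k t" if "s \<le> t" for b s t
      unfolding V_def using bounded_run_mono[OF _ that] by auto
    have "(\<lambda>s. ?\<mu> (V 0 k s \<union> V 1 k s)) \<longlonglongrightarrow> ?\<mu> (\<Union>s. V 0 k s \<union> V 1 k s)"
    proof (intro coin.finite_Lim_measure_incseq monoI)
      show "range (\<lambda>s. V 0 k s \<union> V 1 k s) \<subseteq> sets coin_measure" by auto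
      show "V 0 k s \<union> V 1 k s \<subseteq> V 0 k t \<union> V 1 k t" if "s \<le> t" for s t
        using V_mono[OF that] by (intro Un_mono)
    qed
    moreover have "3/4 * ?\<mu> C < ?\<mu> (\<Union>s. V 0 k s \<union> V 1 k s)"
    proof -
      have "B \<inter> C \<subseteq> (\<Union>s. V 0 k s \<union> V 1 k s)"
      proof
        fix f assume f: "f \<in> B \<inter> C"
        then have "run \<Phi> (Collect f) k = Some 0 \<or> run \<Phi> (Collect f) k = Some 1"
          unfolding B_def by (simp add: describing_iff)
        then obtain s where "bounded_run \<Phi> s (Collect f) k = Some 0 \<or> bounded_run \<Phi> s (Collect f) k = Some 1"
          using bounded_run_complete by blast
        with f show "f \<in> (\<Union>s. V 0 k s \<union> V 1 k s)" by (auto simp: V_def)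
      qed
      then have "?\<mu> (B \<inter> C) \<le> ?\<mu> (\<Union>s. V 0 k s \<union> V 1 k s)"
        by (intro coin.finite_measure_mono) auto
      with lv show ?thesis by (simp add: C_def)
    qed
    ultimately have "eventually (\<lambda>s. 3/4 * ?\<mu> C < ?\<mu> (V 0 k s \<union> V 1 k s)) sequentially"
      by (intro order_tendstoD)
    then obtain N where N: "\<And>s. s \<ge> N \<Longrightarrow> 3/4 * ?\<mu> C < ?\<mu> (V 0 k s \<union> V 1 k s)"
      by (auto simp: eventually_sequentially)
    have "?\<mu> (V 0 k (max l N) \<union> V 1 k (max l N)) \<le> ?\<mu> (V 0 k (max l N)) + ?\<mu> (V 1 k (max l N))"
      by (intro measure_Un_le) auto
    with N[of "max l N"] have "cond k (max l N)" unfolding cond_iff by simp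
    then show ?thesis by blast
  qed
  define S where "S k = (LEAST s. cond k s)" for k
  have S: "cond k (S k)" for k unfolding S_def by (rule LeastI_ex) (rule ex_cond)
  \<comment> \<open>Ties are decided in favour of membership; the answer given always has at least
    half of the votes cast, hence more than 3/8 of \<open>C\<close>.\<close>
  define D where "D = {k. cnt 0 k (S k) \<le> cnt 1 k (S k)}"
  have "computable D"
  proof -
    have some: "bounded_run \<Phi> s Z k = Some b \<longleftrightarrow> option_code (bounded_run \<Phi> s Z k) = Suc b" for s Z k b
      by (simp add: option_code_def split: option.splits)
    \<comment> \<open>The count depends on the fixed finite data \<open>l\<close>, \<open>v\<close>
      and \<Phi> and on finite oracles only, so it is computable from the empty oracle.\<close>
    have cnt: "computable_fun {} (\<lambda>z. cnt b (f z) (g z))"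
      if "computable_fun {} f" "computable_fun {} g" for b f g
      unfolding cnt_def some
      by (intro computability computable_fun_bounded_run computable_fun_comp[OF that(1)] computable_fun_comp[OF that(2)] that)
    have "computable_fun {} S"
      unfolding S_def
      by (rule computable_fun_Least[OF _ ex_cond]) (unfold cond_def, intro computability cnt)
    then have "computable_pred {} (\<lambda>k. k \<in> D)"
      unfolding D_def mem_Collect_eq by (intro computability cnt)
    then show ?thesis by (simp add: computable_def turing_le_iff_computable_pred)
  qed
  moreover have "coarse_description D A"
    unfolding coarse_description_def
  proof (rule has_density_0_subset)
    show "has_density {k. ?\<mu> (error_event \<Phi> A k) \<ge> ?\<mu> C / 8} 0"
      by (rule has_density_0_large_error) (simp add: \<mu>C)
    show "sym_diff D A \<subseteq> {k. ?\<mu> (error_event \<Phi> A k) \<ge> ?\<mu> C / 8}"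
    proof
      fix k assume k: "k \<in> sym_diff D A"
      define b :: nat where "b = of_bool (k \<in> D)"
      let ?V = "V b k (S k)"
      have "l \<le> S k" and sum: "?\<mu> (V 0 k (S k)) + ?\<mu> (V 1 k (S k)) > 3/4 * ?\<mu> C"
        using S[of k] by (simp_all add: cond_iff)
      have "?\<mu> (V (1 - b) k (S k)) \<le> ?\<mu> ?V"
        unfolding V_measure[OF \<open>l \<le> S k\<close>] by (auto simp: b_def D_def intro!: divide_right_mono)
      with sum have "?\<mu> ?V > 3/8 * ?\<mu> C"
        by (auto simp: b_def split: if_splits)
      moreover have "?V \<subseteq> C" by (auto simp: V_def)
      \<comment> \<open>The voters for \<open>b\<close> fill more than 3/8 of \<open>C\<close> and
        the class more than 3/4, so they share more than 1/8. Where \<open>D\<close> is wrong at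
        \<open>k\<close>, these common members err as well.\<close>
      then have "?\<mu> (?V \<inter> (B \<inter> C)) \<ge> ?\<mu> ?V + ?\<mu> (B \<inter> C) - ?\<mu> C"
        by (intro measure_Int_ge) auto
      moreover have "?\<mu> (?V \<inter> (B \<inter> C)) \<le> ?\<mu> (error_event \<Phi> A k)"
      proof (intro coin.finite_measure_mono sets_error_event subsetI)
        fix f assume f: "f \<in> ?V \<inter> (B \<inter> C)"
        then have "run \<Phi> (Collect f) k = Some b" unfolding V_def using bounded_run_sound by blast
        with f k show "f \<in> error_event \<Phi> A k"
          by (auto simp: error_event_def B_def b_def)
      qed
      ultimately show "k \<in> {k. ?\<mu> (error_event \<Phi> A k) \<ge> ?\<mu> C / 8}"
        using lv unfolding C_def[symmetric] by simp
    qed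
  qed
  ultimately show ?thesis unfolding coarsely_computable_def by blast
qed

section \<open>Application to weakly 3-random sets\<close>

text \<open>If the sets close to \<open>E\<close> filled \<open>3/4\<close> of a cylinder, then each coordinate beyond the cylinder
  would differ from \<open>E\<close> on at least \<open>1/4\<close> of it.\<close>

lemma measure_describing_Oracle: "measure coin_measure {f. Collect f \<in> describing Oracle E} = 0"
proof (rule ccontr)
  let ?\<mu> = "measure coin_measure"
  define B where "B = {f. Collect f \<in> describing Oracle E}"
  assume "\<not> ?thesis"
  then have "?\<mu> B > 0" unfolding B_def by (simp add: less_le)
  moreover have B [measurable]: "B \<in> sets coin_measure" unfolding B_def by (rule sets_describing)
  ultimately obtain l v where lv: "?\<mu> (B \<inter> cylinder l v) > 3/4 * ?\<mu> (cylinder l v)"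
    using ex_cylinder_dense by blast
  define C where "C = cylinder l v"
  have C [measurable]: "C \<in> sets coin_measure" unfolding C_def by measurable
  have \<mu>C: "?\<mu> C = (1/2) ^ l" unfolding C_def by (rule measure_cylinder)
  have large: "?\<mu> (error_event Oracle E k) \<ge> ?\<mu> C / 4" if "k \<ge> l" for k
  proof -
    \<comment> \<open>For \<open>k \<ge> l\<close> this is exactly half of \<open>C\<close>; it
      meets the class in at least a quarter of \<open>C\<close>, since
      \<open>1/2 + 3/4 - 1 = 1/4\<close>.\<close>
    define V where "V = C \<inter> {f. f k = (k \<notin> E)}"
    have V [measurable]: "V \<in> sets coin_measure" unfolding V_def by measurable
    have "V = {f. \<forall>i\<in>insert k {..<l}. f i = (if i = k then k \<notin> E else i \<in> set_decode v)}"
      using that by (auto simp: V_def C_def cylinder_def)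
    then have "?\<mu> V = (1/2) ^ card (insert k {..<l})"
      by (simp only: measure_coin_cylinder finite_insert finite_lessThan)
    then have "?\<mu> V = ?\<mu> C / 2" using that by (simp add: \<mu>C)
    moreover have "?\<mu> (V \<inter> (B \<inter> C)) \<ge> ?\<mu> V + ?\<mu> (B \<inter> C) - ?\<mu> C"
      by (intro measure_Int_ge) (auto simp: V_def)
    moreover have "?\<mu> (V \<inter> (B \<inter> C)) \<le> ?\<mu> (error_event Oracle E k)"
      by (intro coin.finite_measure_mono sets_error_event) (auto simp: V_def B_def error_event_def)
    ultimately show ?thesis using lv unfolding C_def[symmetric] by simp
  qed
  have "has_density {k. ?\<mu> (error_event Oracle E k) \<ge> ?\<mu> C / 4} 0"
    by (rule has_density_0_large_error) (simp add: \<mu>C)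
  then have "has_density {l..} 0"
    by (rule has_density_0_subset) (use large in auto)
  then obtain b where "\<And>n. n \<ge> b \<Longrightarrow> 2 * card ({l..} \<inter> {0..<n}) \<le> n"
    unfolding has_density_0_iff by blast
  \<comment> \<open>At this length \<open>{l..}\<close> has \<open>l + b + 1\<close> elements, more
    than half of all.\<close>
  from this[of "2 * l + b + 1"] have "2 * card ({l..} \<inter> {0..<2 * l + b + 1}) \<le> 2 * l + b + 1" by simp
  moreover have "{l..} \<inter> {0..<2 * l + b + 1} = {l..<2 * l + b + 1}" by auto
  ultimately show False by simp
qed

lemma null_class_describing_iff:
  "null_class (describing \<Phi> A) \<longleftrightarrow> measure coin_measure {f. Collect f \<in> describing \<Phi> A} = 0"
  using sets_describing by (auto simp: null_class_def coin.emeasure_eq_measure null_sets_def)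

lemma coarsely_computable_if_computed_from_random:
  assumes "weakly_3_random_rel X Y" "A \<le>\<^sub>T Y" "D \<le>\<^sub>T X" "coarse_description D A"
  shows "coarsely_computable A"
proof -
  obtain \<Phi> where "X \<in> describing \<Phi> A"
    using assms(3,4) unfolding turing_le_def describing_def by blast
  then have "\<not> null_class (describing \<Phi> A)"
    using assms(1,2) Pi03_class_describing unfolding weakly_3_random_rel_def by blast
  then have "measure coin_measure {f. Collect f \<in> describing \<Phi> A} > 0"
    by (simp add: null_class_describing_iff less_le)
  then show ?thesis by (rule coarsely_computable_if_describing_positive)
qed

text \<open>For the functional \<open>Oracle\<close> the class consists of all sets coarsely equal
  to \<open>E\<close>. It is null, yet a computable coarse description \<open>E\<close> of
  \<open>X\<close> would place \<open>X\<close> in it.\<close>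

lemma not_coarsely_computable_if_random:
  assumes "weakly_3_random_rel X Y"
  shows "\<not> coarsely_computable X"
proof
  assume "coarsely_computable X"
  then obtain E where E: "computable E" "coarse_description E X"
    unfolding coarsely_computable_def by blast
  have "{} \<le>\<^sub>T Y"
    unfolding turing_le_def computes_set_def by (intro exI[of _ Zero]) simp
  with E(1) have "E \<le>\<^sub>T Y" unfolding computable_def by (rule turing_le_trans)
  moreover have "X \<in> describing Oracle E"
    unfolding describing_def using coarse_description_sym[OF E(2)] by (auto simp: computes_set_def)
  ultimately show False
    using assms Pi03_class_describing null_class_describing_iff measure_describing_Oracle
    unfolding weakly_3_random_rel_def by blast
qed

section \<open>Minimal pairs of degrees\<close>

lemma least_degree_of_iff:
  assumes refl: "\<And>A. le A A"
    and least: "\<And>a. least_degree le a \<longleftrightarrow> a = {A. coarsely_computable A}"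
    and down: "\<And>A B. le A B \<Longrightarrow> coarsely_computable B \<Longrightarrow> coarsely_computable A"
    and bot: "\<And>A B. coarsely_computable A \<Longrightarrow> le A B"
  shows "least_degree le (degree_of le A) \<longleftrightarrow> coarsely_computable A"
proof
  assume "least_degree le (degree_of le A)"
  then show "coarsely_computable A" using refl[of A] mem_degree_of[of A le A] by (simp add: least)
next
  assume "coarsely_computable A"
  then have "degree_of le A = {B. coarsely_computable B}"
    using down bot by (auto simp: mem_degree_of)
  then show "least_degree le (degree_of le A)" by (simp add: least)
qed

text \<open>Working with an arbitrary preorder reduces both degree structures to statements about
  representatives.\<close>

lemma minimal_pair_degree_ofI:
  assumes refl: "\<And>A. le A A" and trans: "\<And>A B C. le A B \<Longrightarrow> le B C \<Longrightarrow> le A C"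
    and least: "\<And>A. least_degree le (degree_of le A) \<longleftrightarrow> coarsely_computable A"
    and "\<not> coarsely_computable X" "\<not> coarsely_computable Y"
    and meet: "\<And>Z. le Z X \<Longrightarrow> le Z Y \<Longrightarrow> coarsely_computable Z"
  shows "minimal_pair le (degree_of le X) (degree_of le Y)"
  unfolding minimal_pair_def
proof (intro conjI ballI impI degree_of_in_degrees)
  show "\<not> least_degree le (degree_of le X)" "\<not> least_degree le (degree_of le Y)"
    using assms by simp_all
  fix c assume "c \<in> degrees le" and c: "degree_le le c (degree_of le X) \<and> degree_le le c (degree_of le Y)"
  then obtain Z where Z: "c = degree_of le Z" by (elim degrees_cases)
  show "least_degree le c"
    using c meet unfolding Z least by (simp add: degree_le_degree_of_iff[of le, OF refl trans])
qed

theorem corollary5p3: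
  fixes X Y :: "nat set"
  assumes "\<not> coarsely_computable Y"
    and "weakly_3_random_rel X Y"
  shows "minimal_pair nc_le (nc_degree X) (nc_degree Y) \<and>
         minimal_pair uc_le (uc_degree X) (uc_degree Y)"
proof -
  have down: "coarsely_computable A" if "A \<le>\<^sub>n\<^sub>c B" "coarsely_computable B" for A B
    using nc_le_trans[of A B "{}"] that by (simp add: nc_le_empty_iff)
  \<comment> \<open>\<open>Z\<close> itself may fail to be computable from \<open>Y\<close>, so the
    argument is applied to a coarse description \<open>E\<close> of \<open>Z\<close> that is; the
    result carries over to \<open>Z\<close> by transitivity.\<close>
  have meet: "coarsely_computable Z" if X: "Z \<le>\<^sub>n\<^sub>c X" and Y: "Z \<le>\<^sub>n\<^sub>c Y" for Z
  proof -
    obtain D where D: "D \<le>\<^sub>T X" "coarse_description D Z"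
      using X coarse_description_refl unfolding nc_le_def by blast
    obtain E where E: "E \<le>\<^sub>T Y" "coarse_description E Z"
      using Y coarse_description_refl unfolding nc_le_def by blast
    have "coarse_description D E"
      using D(2) coarse_description_sym[OF E(2)] by (rule coarse_description_trans)
    with assms(2) E(1) D(1) have "coarsely_computable E"
      by (rule coarsely_computable_if_computed_from_random)
    then show ?thesis
      unfolding coarsely_computable_def using E(2) coarse_description_trans by blast
  qed
  have X: "\<not> coarsely_computable X"
    using assms(2) by (rule not_coarsely_computable_if_random)
  show ?thesis
  proof (intro conjI minimal_pair_degree_ofI least_degree_of_iff X assms(1))
    \<comment> \<open>A uniform lower bound is also a nonuniform one, and both structures have the
      same least degree.\<close>
    show "coarsely_computable Z" if "Z \<le>\<^sub>u\<^sub>c X" "Z \<le>\<^sub>u\<^sub>c Y" for Z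
      using that meet uc_le_imp_nc_le by blast
    show "coarsely_computable A" if "A \<le>\<^sub>u\<^sub>c B" "coarsely_computable B" for A B
      using that down uc_le_imp_nc_le by blast
  qed (fact nc_le_refl uc_le_refl nc_le_trans uc_le_trans least_nc_degree_iff least_uc_degree_iff
      meet down coarsely_computable_imp_uc_le uc_le_imp_nc_le[OF coarsely_computable_imp_uc_le])+
qed

end
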